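(* Assume that the problem $$dx(t)=f(t,x(t),x(t-\tau(t)))\,dt+g(t,x(t),x(t-\tau(t)))\,dw(t),\ t\in[a,b],\qquad x(t)=\xi(t),\ t\in[a-\tau_0,a],$$ belongs to $\mathcal{SD}(\alpha,\beta,\gamma_1,\gamma_2)$ with constant $\alpha,\beta,\gamma_1,\gamma_2$. Let $\{X_n\}$ and $\{Y_n\}$ be the two sequences of numerical solutions obtained by the backward Euler method with stepsize $h=(b-a)/N$ (same $f,g,\tau,w$) from initial functions $\xi$ and $\eta$ respectively, $\xi,\eta\in L^p_{\mathcal F_a}([a-\tau_0,a];\mathbb C^d)$. Write $c=2\alpha+2\beta+\gamma_1^2+2\gamma_1\gamma_2+\gamma_2^2$. (i) If $c>0$, then for any given $c_0\in(0,1)$ and all $h$ with $hc\le c_0$, $$\mathbb E|X_n-Y_n|^2\le e^{\tilde c(t_n-a)}\sup_{a-\tau_0\le t\le a}\mathbb E|\xi(t)-\eta(t)|^2,\qquad n=1,2,\dots,N,$$ where $\tilde c=c_1/h$ and $$c_1=\max\left\{\frac{1+h\gamma_1^2+2h\gamma_1\gamma_2+h\gamma_2^2}{1-2h\alpha-2h\beta},\ \frac{1+h\beta+h\gamma_1^2+2h\gamma_1\gamma_2+h\gamma_2^2}{1-2h\alpha-h\beta}\right\}=\frac{1+h\gamma_1^2+2h\gamma_1\gamma_2+h\gamma_2^2}{1-2h\alpha-2h\beta}>1.$$ (ii) If $c\le0$, then for any $h>0$, $$\mathbb E|X_n-Y_n|^2\le\sup_{a-\tau_0\le t\le a}\mathbb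 E|\xi(t)-\eta(t)|^2,\qquad n=1,2,\dots,N.$$
   Context: Setting. $(\Omega,\mathcal F,\{\mathcal F_t\}_{t\ge a},\mathbb P)$ is a complete probability space with a filtration satisfying the usual conditions (right continuous, $\mathcal F_a$ contains all $\mathbb P$-null sets), and $w$ is an $m$-dimensional Wiener process on it. $\langle\cdot,\cdot\rangle$ is the inner product on $\mathbb C^d$ and $|\cdot|$ the corresponding norm; on $\mathbb C^{d\times m}$, $|\cdot|$ is the trace (Frobenius) norm. $\Re$ denotes real part. A number $p>2$ is fixed, and $L^p_{\mathcal F_t}([t_1,t_2];\mathbb C^d)$ is the family of $\mathcal F_t$-measurable $C([t_1,t_2];\mathbb C^d)$-valued random variables $\psi$ with $\sup_{t_1\le u\le t_2}\mathbb E|\psi(u)|^p<\infty$. The constants $a,b,\tau_0$ satisfy $-\infty<a<b<+\infty$, $\tau_0\ge0$; the delay satisfies $\tau(t)\ge0$ and $\inf_{a\le t\le b}(t-\tau(t))\ge a-\tau_0$; $f:[a,b]\times\mathbb C^d\times\mathbb C^d\to\mathbb C^d$ and $g:[a,b]\times\mathbb C^d\times\mathbb C^d\to\mathbb C^{d\times m}$ are continuous. The problem belongs to $\mathcal{SD}(\alpha,\beta,\gamma_1,\gamma_2)$ (here with real constants $\alpha,\beta,\gamma_1,\gamma_2$) if for all $t\in[a,b]$ and $x,x_1,x_2,y,y_1,y_2\in\mathbb C^d$: (1) for each $R>0$ there is a constant $C_R$ depending only on $R$ with $|f(t,x_1,y)-f(t,x_2,y)|\le C_R|x_1-x_2|$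 whenever $|x_1|,|x_2|,|y|\le R$; (2) $\Re\langle x_1-x_2,f(t,x_1,y)-f(t,x_2,y)\rangle\le\alpha|x_1-x_2|^2$; (3) $|f(t,x,y_1)-f(t,x,y_2)|\le\beta|y_1-y_2|$; (4) $|g(t,x_1,y_1)-g(t,x_2,y_2)|\le\gamma_1|x_1-x_2|+\gamma_2|y_1-y_2|$. Backward Euler method: with $h=(b-a)/N$, $t_n=a+nh$, $\Delta w_n=w(t_{n+1})-w(t_n)$, $X_0=\xi(a)$, $$X_{n+1}=X_n+hf\big(t_{n+1},X_{n+1},X^h(t_{n+1}-\tau(t_{n+1}))\big)+g\big(t_n,X_n,X^h(t_n-\tau(t_n))\big)\Delta w_n,\quad n=0,\dots,N-1,$$ where $X^h(t)=\xi(t)$ for $a-\tau_0\le t\le a$ and $X^h(t)=\frac1h[(t_{i+1}-t)X_i+(t-t_i)X_{i+1}]$ for $t_i\le t\le t_{i+1}$. $\{Y_n\}$ is defined in the same way with $\eta$ in place of $\xi$. *)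

theory Defs
  imports "HOL-Probability.Probability"
begin

section \<open>Stochastic basis and Wiener process\<close>

text \<open>The filtration is only meaningful for times \<open>t \<ge> a\<close>; values of \<open>F\<close> and \<open>w\<close> before \<open>a\<close>
  are unconstrained.\<close>

locale stochastic_basis = prob_space M + complete_measure M
  for M :: "'w measure" +
  fixes F :: "real \<Rightarrow> 'w measure" and a :: real
  assumes filtration_subalgebra: "a \<le> t \<Longrightarrow> subalgebra M (F t)"
    and filtration_mono: "a \<le> s \<Longrightarrow> s \<le> t \<Longrightarrow> sets (F s) \<subseteq> sets (F t)"
    and filtration_right_continuous: "a \<le> t \<Longrightarrow> sets (F t) = (\<Inter>s\<in>{t<..}. sets (F s))"
    and filtration_null_sets: "null_sets M \<subseteq> sets (F a)"

text \<open>No normalisation of the initial value \<open>w a\<close> is imposed: only increments of \<open>w\<close> enter the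
  scheme, and \<open>a\<close> need not be \<open>0\<close>.\<close>

locale wiener_process = stochastic_basis M F a
  for M :: "'w measure" and F :: "real \<Rightarrow> 'w measure" and a :: real +
  fixes w :: "real \<Rightarrow> 'w \<Rightarrow> real ^ 'm"
  assumes wiener_adapted: "a \<le> t \<Longrightarrow> w t \<in> borel_measurable (F t)"
    and wiener_continuous: "AE \<omega> in M. continuous_on {a..} (\<lambda>t. w t \<omega>)"
    and wiener_increment_indep_past: "a \<le> s \<Longrightarrow> s < t \<Longrightarrow>
      indep_set (sets (F s)) {(\<lambda>\<omega>. w t \<omega> - w s \<omega>) -` B \<inter> space M | B. B \<in> sets borel}"
    and wiener_increment_normal: "a \<le> s \<Longrightarrow> s < t \<Longrightarrow>
      distributed M lborel (\<lambda>\<omega>. (w t \<omega> - w s \<omega>) $ j) (normal_density 0 (sqrt (t - s)))"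
    and wiener_increment_indep_components: "a \<le> s \<Longrightarrow> s < t \<Longrightarrow>
      indep_vars (\<lambda>_. borel) (\<lambda>j \<omega>. (w t \<omega> - w s \<omega>) $ j) UNIV"


section \<open>Random functions and moments\<close>

text \<open>\<open>C([t1,t2]; \<complex>\<^sup>d)\<close> is the library's function space with the supremum metric; its elements are
  extensional on \<open>{t1..t2}\<close>, hence the restriction in the definition of \<open>Lp_paths\<close>.\<close>

definition path_space :: "real \<Rightarrow> real \<Rightarrow> (real \<Rightarrow> complex ^ 'd) metric" where
  "path_space t1 t2 = cfunspace (top_of_set {t1..t2}) euclidean_metric"

definition borel_paths :: "real \<Rightarrow> real \<Rightarrow> (real \<Rightarrow> complex ^ 'd) measure" where
  "borel_paths t1 t2 =
     sigma (mspace (path_space t1 t2)) {U. openin (mtopology_of (path_space t1 t2)) U}"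

definition Lp_paths ::
  "'w measure \<Rightarrow> 'w measure \<Rightarrow> real \<Rightarrow> real \<Rightarrow> real \<Rightarrow> (real \<Rightarrow> 'w \<Rightarrow> complex ^ 'd) set" where
  "Lp_paths M G p t1 t2 =
     {\<psi>. (\<lambda>\<omega>. \<lambda>u\<in>{t1..t2}. \<psi> u \<omega>) \<in> G \<rightarrow>\<^sub>M borel_paths t1 t2 \<and>
         (SUP u\<in>{t1..t2}. \<integral>\<^sup>+\<omega>. ennreal (norm (\<psi> u \<omega>) powr p) \<partial>M) < \<infinity>}"

text \<open>Extended nonnegative, so that an inequality between second moments is not satisfied merely
  because an expectation fails to exist.\<close>

definition mean_square :: "'w measure \<Rightarrow> ('w \<Rightarrow> complex ^ 'd) \<Rightarrow> ennreal" where
  "mean_square M Z = (\<integral>\<^sup>+\<omega>. ennreal ((norm (Z \<omega>))\<^sup>2) \<partial>M)"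


section \<open>The delay problem and the class \<open>SD(\<alpha>,\<beta>,\<gamma>1,\<gamma>2)\<close>\<close>

text \<open>Norms on \<open>complex ^ 'd\<close> and \<open>complex ^ 'm ^ 'd\<close> are the library's, i.e. Euclidean and
  Frobenius. The library's inner product on \<open>complex ^ 'd\<close> is only the real one.\<close>

definition hermitian_inner :: "complex ^ 'd \<Rightarrow> complex ^ 'd \<Rightarrow> complex" where
  "hermitian_inner x y = (\<Sum>i\<in>UNIV. x $ i * cnj (y $ i))"

lemma hermitian_inner_self: "hermitian_inner x x = of_real ((norm x)\<^sup>2)"
  by (simp add: hermitian_inner_def complex_norm_square[symmetric] norm_vec_def L2_set_def
      sum_nonneg)

definition delay_problem ::
  "real \<Rightarrow> real \<Rightarrow> real \<Rightarrow> (real \<Rightarrow> real)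
   \<Rightarrow> (real \<Rightarrow> complex ^ 'd \<Rightarrow> complex ^ 'd \<Rightarrow> complex ^ 'd)
   \<Rightarrow> (real \<Rightarrow> complex ^ 'd \<Rightarrow> complex ^ 'd \<Rightarrow> complex ^ 'm ^ 'd) \<Rightarrow> bool" where
  "delay_problem a b \<tau>0 \<tau> f g \<longleftrightarrow>
     a < b \<and> 0 \<le> \<tau>0 \<and>
     (\<forall>t\<in>{a..b}. 0 \<le> \<tau> t) \<and>
     (\<forall>t\<in>{a..b}. a - \<tau>0 \<le> t - \<tau> t) \<and>
     continuous_on ({a..b} \<times> UNIV \<times> UNIV) (\<lambda>(t, x, y). f t x y) \<and>
     continuous_on ({a..b} \<times> UNIV \<times> UNIV) (\<lambda>(t, x, y). g t x y)"

definition SD ::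
  "real \<Rightarrow> real \<Rightarrow> real \<Rightarrow> real \<Rightarrow> real \<Rightarrow> real
   \<Rightarrow> (real \<Rightarrow> complex ^ 'd \<Rightarrow> complex ^ 'd \<Rightarrow> complex ^ 'd)
   \<Rightarrow> (real \<Rightarrow> complex ^ 'd \<Rightarrow> complex ^ 'd \<Rightarrow> complex ^ 'm ^ 'd) \<Rightarrow> bool" where
  "SD \<alpha> \<beta> \<gamma>1 \<gamma>2 a b f g \<longleftrightarrow>
     (\<forall>R>0. \<exists>C. \<forall>t\<in>{a..b}. \<forall>x1 x2 y. norm x1 \<le> R \<and> norm x2 \<le> R \<and> norm y \<le> R \<longrightarrow>
        norm (f t x1 y - f t x2 y) \<le> C * norm (x1 - x2)) \<and>
     (\<forall>t\<in>{a..b}. \<forall>x1 x2 y.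
        Re (hermitian_inner (x1 - x2) (f t x1 y - f t x2 y)) \<le> \<alpha> * (norm (x1 - x2))\<^sup>2) \<and>
     (\<forall>t\<in>{a..b}. \<forall>x y1 y2. norm (f t x y1 - f t x y2) \<le> \<beta> * norm (y1 - y2)) \<and>
     (\<forall>t\<in>{a..b}. \<forall>x1 x2 y1 y2.
        norm (g t x1 y1 - g t x2 y2) \<le> \<gamma>1 * norm (x1 - x2) + \<gamma>2 * norm (y1 - y2))"


section \<open>Backward Euler method\<close>

definition grid :: "real \<Rightarrow> real \<Rightarrow> nat \<Rightarrow> real" where
  "grid a h n = a + real n * h"

text \<open>The continuous extension \<open>X\<^sup>h\<close> of one path. At \<open>t = t\<^sub>N\<close> the index chosen is \<open>N\<close>, but then the
  value \<open>X (N + 1)\<close>, which is not part of the numerical solution, has weight \<open>0\<close>.\<close>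

definition interpolant :: "real \<Rightarrow> real \<Rightarrow> (real \<Rightarrow> 'v::real_vector) \<Rightarrow> (nat \<Rightarrow> 'v) \<Rightarrow> real \<Rightarrow> 'v" where
  "interpolant a h \<xi> X t =
     (if t \<le> a then \<xi> t
      else let i = nat \<lfloor>(t - a) / h\<rfloor> in
        (1 / h) *\<^sub>R ((grid a h (Suc i) - t) *\<^sub>R X i + (t - grid a h i) *\<^sub>R X (Suc i)))"

lemma interpolant_history: "t \<le> a \<Longrightarrow> interpolant a h \<xi> X t = \<xi> t"
  by (simp add: interpolant_def)

lemma interpolant_grid_interval:
  assumes "0 < h" "X 0 = \<xi> a" "grid a h i \<le> t" "t \<le> grid a h (Suc i)"
  shows "interpolant a h \<xi> X t =
    (1 / h) *\<^sub>R ((grid a h (Suc i) - t) *\<^sub>R X i + (t - grid a h i) *\<^sub>R X (Suc i))"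
proof -
  have 1: "real i \<le> (t - a) / h" "(t - a) / h \<le> real i + 1"
    using assms by (auto simp: grid_def field_simps)
  have "0 \<le> real i * h" using assms by simp
  consider "t = a" | "a < t" "t = grid a h (Suc i)" | "a < t" "t < grid a h (Suc i)"
    using assms \<open>0 \<le> real i * h\<close> unfolding grid_def by linarith
  then show ?thesis
  proof cases
    case 1
    then have "i = 0" using assms by (auto simp: grid_def mult_le_0_iff)
    with 1 assms show ?thesis by (simp add: interpolant_def grid_def)
  next
    case 2
    then have "(t - a) / h = real (Suc i)" using assms by (simp add: grid_def)
    then have "nat \<lfloor>(t - a) / h\<rfloor> = Suc i" by (metis floor_of_nat nat_int)
    with 2 assms show ?thesis
      by (simp add: interpolant_def Let_def) (simp add: grid_def algebra_simps)
  next
    case 3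
    then have "(t - a) / h < real i + 1" using assms by (simp add: grid_def field_simps)
    then have "\<lfloor>(t - a) / h\<rfloor> = int i" using 1 by (intro floor_unique) auto
    with 3 show ?thesis by (simp add: interpolant_def Let_def)
  qed
qed

text \<open>Neither solvability of the implicit equations nor adaptedness of the \<open>X n\<close> is part of the
  notion: any sequence satisfying the recursion almost surely is a numerical solution.\<close>

definition backward_euler ::
  "'w measure \<Rightarrow> (real \<Rightarrow> 'w \<Rightarrow> real ^ 'm) \<Rightarrow> real \<Rightarrow> real \<Rightarrow> nat \<Rightarrow> (real \<Rightarrow> real)
   \<Rightarrow> (real \<Rightarrow> complex ^ 'd \<Rightarrow> complex ^ 'd \<Rightarrow> complex ^ 'd)
   \<Rightarrow> (real \<Rightarrow> complex ^ 'd \<Rightarrow> complex ^ 'd \<Rightarrow> complex ^ 'm ^ 'd)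
   \<Rightarrow> (real \<Rightarrow> 'w \<Rightarrow> complex ^ 'd) \<Rightarrow> (nat \<Rightarrow> 'w \<Rightarrow> complex ^ 'd) \<Rightarrow> bool" where
  "backward_euler M w a h N \<tau> f g \<xi> X \<longleftrightarrow>
     (AE \<omega> in M.
        let Xh = interpolant a h (\<lambda>t. \<xi> t \<omega>) (\<lambda>k. X k \<omega>); t = grid a h in
        X 0 \<omega> = \<xi> a \<omega> \<and>
        (\<forall>n<N. X (Suc n) \<omega> =
           X n \<omega>
           + h *\<^sub>R f (t (Suc n)) (X (Suc n) \<omega>) (Xh (t (Suc n) - \<tau> (t (Suc n))))
           + g (t n) (X n \<omega>) (Xh (t n - \<tau> (t n)))
               *v (\<chi> j. complex_of_real ((w (t (Suc n)) \<omega> - w (t n) \<omega>) $ j))))"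

end

theory Submission
  imports Defs
begin

text \<open>Let \<open>D\<^sub>n = X\<^sub>n - Y\<^sub>n\<close> and let \<open>\<Delta>f\<close>, \<open>\<Delta>g\<close> be the differences of the coefficients along the two
  solutions. The scheme reads \<open>D\<^sub>n\<^sub>+\<^sub>1 - h \<Delta>f = D\<^sub>n + \<Delta>g \<Delta>w\<^sub>n\<close>. On the left, the one-sided Lipschitz condition
  bounds the squared norm from below; on the right, the increment is independent of the past, so
  the cross term has mean zero and \<open>E|D\<^sub>n + \<Delta>g \<Delta>w\<^sub>n|\<^sup>2 = E|D\<^sub>n|\<^sup>2 + h E|\<Delta>g|\<^sup>2\<close>. The delayed values are convex
  combinations of the history and of \<open>D\<^sub>0, \<dots>, D\<^sub>n\<^sub>+\<^sub>1\<close>. With \<open>P = 1 + h(\<gamma>\<^sub>1 + \<gamma>\<^sub>2)\<^sup>2\<close>, \<open>Q = 1 - 2h\<alpha> - 2h\<beta>\<close>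
  and \<open>1 - \<mu>\<close> the weight of \<open>D\<^sub>n\<^sub>+\<^sub>1\<close> in the delayed argument of \<open>f\<close>, a bound \<open>K\<close> for the past thus yields
  \<open>(Q + h\<beta>\<mu>) E|D\<^sub>n\<^sub>+\<^sub>1|\<^sup>2 \<le> (P + h\<beta>\<mu>) K\<close>, and \<open>P + h\<beta>\<mu> \<le> r (Q + h\<beta>\<mu>)\<close> as soon as \<open>r \<ge> 1\<close> and \<open>P \<le> r Q\<close>.
  The independence argument needs the \<open>X\<^sub>n\<close> to be adapted, which follows because the implicit equation
  has at most one solution, depending continuously on the data.\<close>

section \<open>Interpolation weights\<close>

text \<open>Lets the one-sided Lipschitz condition be used through the real inner product, where
  Cauchy-Schwarz and the expansion of squared norms apply.\<close>

lemma Re_hermitian_inner: "Re (hermitian_inner x y) = x \<bullet> y"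
  by (simp add: hermitian_inner_def inner_vec_def inner_complex_def)

text \<open>The history is evaluated at \<open>min t a\<close> so that the formula never refers to \<open>\<xi>\<close> after time \<open>a\<close>;
  for \<open>t > a\<close> its weight is \<open>0\<close>.\<close>

lemma interpolant_convex_combination:
  fixes t :: real
  assumes "0 < h" "t \<le> grid a h n"
  obtains u v where "0 \<le> u" "\<And>k. 0 \<le> v k" "u + (\<Sum>k\<le>n. v k) = 1"
    "\<And>\<xi> (X :: nat \<Rightarrow> 'v::real_vector).
       interpolant a h \<xi> X t = u *\<^sub>R \<xi> (min t a) + (\<Sum>k\<le>n. v k *\<^sub>R X k)"
proof (cases "t \<le> a")
  case True
  show ?thesis
    by (rule that[of 1 "\<lambda>_. 0"]) (use True in \<open>auto simp: interpolant_history min_absorb1\<close>)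
next
  case False
  \<comment> \<open>The ceiling minus one, rather than the floor, makes a grid point the right end
    of its interval; hence \<open>Suc i \<le> n\<close> and no value beyond index \<open>n\<close>
    enters.\<close>
  define i where "i = nat (\<lceil>(t - a) / h\<rceil> - 1)"
  define \<mu> where "\<mu> = (t - grid a h i) / h"
  have pos: "0 < (t - a) / h" using False assms by simp
  have ri: "real i = of_int \<lceil>(t - a) / h\<rceil> - 1"
    using pos unfolding i_def by simp
  have i: "real i < (t - a) / h" "(t - a) / h \<le> real (Suc i)"
    unfolding ri of_nat_Suc by linarith+
  have "(t - a) / h \<le> real n"
    using assms by (simp add: grid_def field_simps)
  with i have "Suc i \<le> n" by linarith
  have lo: "grid a h i \<le> t" and hi: "t \<le> grid a h (Suc i)"
    using i assms by (auto simp: grid_def field_simps)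
  have \<mu>: "0 \<le> \<mu>" "\<mu> \<le> 1"
    using lo hi assms by (auto simp: \<mu>_def grid_def field_simps)
  define v where "v k = (if k = i then 1 - \<mu> else 0) + (if k = Suc i then \<mu> else 0)" for k
  have "interpolant a h \<xi> X t = 0 *\<^sub>R \<xi> (min t a) + (\<Sum>k\<le>n. v k *\<^sub>R X k)"
    for \<xi> and X :: "nat \<Rightarrow> 'v"
  proof -
    \<comment> \<open>\<open>interpolant_grid_interval\<close> asks the history to equal
      \<open>X 0\<close> at \<open>a\<close>. Since \<open>t > a\<close>, the history is irrelevant
      here and the constant \<open>X 0\<close> may replace it.\<close>
    have "interpolant a h \<xi> X t = interpolant a h (\<lambda>_. X 0) X t"
      using False by (simp add: interpolant_def)
    also have "\<dots> = (1 / h) *\<^sub>R ((grid a h (Suc i) - t) *\<^sub>R X i + (t - grid a h i) *\<^sub>R X (Suc i))"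
      using lo hi assms by (intro interpolant_grid_interval) auto
    also have "\<dots> = (1 - \<mu>) *\<^sub>R X i + \<mu> *\<^sub>R X (Suc i)"
    proof -
      have "(grid a h (Suc i) - t) / h = 1 - \<mu>"
        using assms by (simp add: \<mu>_def grid_def field_simps)
      then show ?thesis by (simp add: \<mu>_def scaleR_add_right)
    qed
    also have "\<dots> = (\<Sum>k\<le>n. v k *\<^sub>R X k)"
      using \<open>Suc i \<le> n\<close>
      by (simp add: v_def scaleR_add_left sum.distrib if_distrib[of "\<lambda>c. c *\<^sub>R _"] cong: if_cong)
    finally show ?thesis by simp
  qed
  moreover have "0 + (\<Sum>k\<le>n. v k) = 1"
    using \<open>Suc i \<le> n\<close> by (simp add: v_def sum.distrib)
  ultimately show ?thesis
    using \<mu> by (intro that[of 0 v]) (auto simp: v_def)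
qed

text \<open>Jensen's inequality for the square: after the triangle inequality, the gap is the
  variance of the norms about their weighted mean \<open>m\<close>, hence nonnegative.\<close>

lemma norm_convex_combination_square_le:
  fixes x :: "'v::real_normed_vector" and y :: "nat \<Rightarrow> 'v"
  assumes "0 \<le> u" "\<And>k. 0 \<le> v k" "u + (\<Sum>k\<le>n. v k) = 1"
  shows "(norm (u *\<^sub>R x + (\<Sum>k\<le>n. v k *\<^sub>R y k)))\<^sup>2
       \<le> u * (norm x)\<^sup>2 + (\<Sum>k\<le>n. v k * (norm (y k))\<^sup>2)"
proof -
  have "norm (u *\<^sub>R x + (\<Sum>k\<le>n. v k *\<^sub>R y k)) \<le> u * norm x + (\<Sum>k\<le>n. v k * norm (y k))"
    using assms(1,2)
    by (intro norm_triangle_le add_mono order.trans[OF norm_sum] sum_mono) auto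
  then have "(norm (u *\<^sub>R x + (\<Sum>k\<le>n. v k *\<^sub>R y k)))\<^sup>2 \<le> (u * norm x + (\<Sum>k\<le>n. v k * norm (y k)))\<^sup>2"
    by (rule power_mono) simp
  also have "\<dots> \<le> u * (norm x)\<^sup>2 + (\<Sum>k\<le>n. v k * (norm (y k))\<^sup>2)"
  proof -
    define m where "m = u * norm x + (\<Sum>k\<le>n. v k * norm (y k))"
    have "0 \<le> u * (norm x - m)\<^sup>2 + (\<Sum>k\<le>n. v k * (norm (y k) - m)\<^sup>2)"
      using assms(1,2) by (intro add_nonneg_nonneg sum_nonneg) auto
    also have "\<dots> = (u * (norm x)\<^sup>2 + (\<Sum>k\<le>n. v k * (norm (y k))\<^sup>2))
        - 2 * m * (u * norm x + (\<Sum>k\<le>n. v k * norm (y k))) + m\<^sup>2 * (u + (\<Sum>k\<le>n. v k))"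
      by (simp add: power2_diff algebra_simps sum.distrib sum_subtractf sum_distrib_left)
         (simp add: sum_distrib_right)
    also have "\<dots> = (u * (norm x)\<^sup>2 + (\<Sum>k\<le>n. v k * (norm (y k))\<^sup>2)) - m\<^sup>2"
      unfolding assms(3) m_def[symmetric] by (simp add: power2_eq_square)
    finally show ?thesis by (simp add: m_def)
  qed
  finally show ?thesis .
qed

section \<open>Measurability of implicit solutions and of path evaluations\<close>

text \<open>By compactness the set of parameters that admit a solution is closed, and the solution is
  continuous there.\<close>

lemma borel_implicit_solution:
  fixes \<Phi> :: "'p::euclidean_space \<Rightarrow> 'x::euclidean_space \<Rightarrow> 'x"
  assumes cont: "continuous_on UNIV (\<lambda>(p, x). \<Phi> p x)"
    and "0 < \<kappa>" and expand: "\<And>p x y. \<kappa> * norm (x - y) \<le> norm (\<Phi> p x - \<Phi> p y)"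
  obtains S where "S \<in> borel_measurable borel" "\<And>p x. \<Phi> p x = 0 \<Longrightarrow> x = S p"
proof -
  define D where "D = {p. \<exists>x. \<Phi> p x = 0}"
  define S where "S p = (SOME x. \<Phi> p x = 0)" for p
  have S: "\<Phi> p (S p) = 0" if "p \<in> D" for p
    using that unfolding D_def S_def by (auto intro: someI)
  have cont_seq: "(\<lambda>n. \<Phi> (q n) (z n)) \<longlonglongrightarrow> \<Phi> p x" if "q \<longlonglongrightarrow> p" "z \<longlonglongrightarrow> x" for q z p x
    using continuous_on_tendsto_compose[OF cont tendsto_Pair[OF that]] by simp
  have S_unique: "x = S p" if "\<Phi> p x = 0" for p x
  proof -
    have "\<kappa> * norm (x - S p) \<le> 0"
      using expand[of x "S p" p] that S[of p] unfolding D_def by force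
    then show ?thesis using \<open>0 < \<kappa>\<close> by (simp add: mult_le_0_iff)
  qed
  \<comment> \<open>The residual at a trial point controls its distance to the solution. Trial point
    \<open>0\<close> yields the boundedness behind closedness of \<open>D\<close>, trial point
    \<open>S p\<close> yields continuity.\<close>
  have close: "\<kappa> * norm (S q - x) \<le> norm (\<Phi> q x)" if "q \<in> D" for q x
    using expand[of "S q" x q] S[OF that] by simp
  have "closed D"
    unfolding closed_sequential_limits
  proof (intro allI impI, elim conjE)
    fix q p assume q: "\<forall>n. q n \<in> D" and lim: "q \<longlonglongrightarrow> p"
    have "Bseq (\<lambda>n. \<Phi> (q n) 0)"
      by (rule convergent_imp_Bseq) (use cont_seq[OF lim tendsto_const] in \<open>auto simp: convergent_def\<close>)
    then obtain K where K: "norm (\<Phi> (q n) 0) \<le> K" for n by (auto simp: Bseq_def)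
    have "bounded (range (\<lambda>n. S (q n)))"
      unfolding bounded_iff
    proof (intro exI[of _ "K / \<kappa>"] ballI, elim rangeE, clarsimp)
      fix n show "norm (S (q n)) \<le> K / \<kappa>"
        using close[of "q n" 0] q K[of n] \<open>0 < \<kappa>\<close> by (auto simp: field_simps)
    qed
    then obtain l r where r: "strict_mono r" and l: "(\<lambda>n. S (q (r n))) \<longlonglongrightarrow> l"
      using bounded_imp_convergent_subsequence[of "\<lambda>n. S (q n)"] by (auto simp: o_def)
    have "(\<lambda>n. \<Phi> (q (r n)) (S (q (r n)))) \<longlonglongrightarrow> \<Phi> p l"
      using LIMSEQ_subseq_LIMSEQ[OF lim r] l by (intro cont_seq) (auto simp: o_def)
    then have "(\<lambda>n. 0) \<longlonglongrightarrow> \<Phi> p l" using q S by simp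
    then have "\<Phi> p l = 0" by (simp add: LIMSEQ_const_iff)
    then show "p \<in> D" by (auto simp: D_def)
  qed
  have "continuous_on D S"
    unfolding continuous_on_sequentially
  proof (intro allI ballI impI, elim conjE)
    fix q p assume p: "p \<in> D" and q: "\<forall>n. q n \<in> D" and lim: "q \<longlonglongrightarrow> p"
    have "(\<lambda>n. norm (\<Phi> (q n) (S p)) / \<kappa>) \<longlonglongrightarrow> norm (\<Phi> p (S p)) / \<kappa>"
      by (intro tendsto_intros cont_seq lim) (use \<open>0 < \<kappa>\<close> in auto)
    then have lim0: "(\<lambda>n. norm (\<Phi> (q n) (S p)) / \<kappa>) \<longlonglongrightarrow> 0" using S[OF p] by simp
    have "(\<lambda>n. S (q n) - S p) \<longlonglongrightarrow> 0"
      by (rule Lim_null_comparison[OF _ lim0])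
         (use close q \<open>0 < \<kappa>\<close> in \<open>auto simp: field_simps\<close>)
    then show "(S \<circ> q) \<longlonglongrightarrow> S p" by (simp add: o_def LIM_zero_iff)
  qed
  \<comment> \<open>Off the closed set \<open>D\<close> the choice is replaced by \<open>0\<close>;
    the claim only concerns parameters that admit a solution.\<close>
  then have "(\<lambda>p. indicator D p *\<^sub>R S p) \<in> borel_measurable borel"
    using \<open>closed D\<close> by (intro borel_measurable_continuous_on_indicator) auto
  moreover have "x = indicator D p *\<^sub>R S p" if "\<Phi> p x = 0" for p x
  proof -
    have "p \<in> D" using that by (auto simp: D_def)
    then show ?thesis using S_unique[OF that] by simp
  qed
  ultimately show ?thesis by (rule that)
qed

text \<open>Point evaluation is nonexpansive for the supremum metric, hence continuous, hence Borel
  on the path space; it is then composed with the random path.\<close>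

lemma Lp_paths_evaluation_measurable:
  assumes \<psi>: "\<psi> \<in> Lp_paths M G p t1 t2" and u: "u \<in> {t1..t2}"
  shows "\<psi> u \<in> borel_measurable G"
proof -
  let ?P = "path_space t1 t2 :: (real \<Rightarrow> complex ^ 'd) metric"
  have "(\<lambda>\<phi>. \<phi> u) \<in> borel_paths t1 t2 \<rightarrow>\<^sub>M (borel :: (complex ^ 'd) measure)"
  proof (rule borel_measurableI)
    fix U :: "(complex ^ 'd) set" assume "open U"
    have "openin (mtopology_of ?P) {\<phi> \<in> mspace ?P. \<phi> u \<in> U}"
      unfolding mtopology_of_def
    proof (subst Metric_space.openin_mtopology, simp, intro conjI allI impI)
      fix \<phi> assume \<phi>: "\<phi> \<in> {\<phi> \<in> mspace ?P. \<phi> u \<in> U}"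
      then obtain e where "0 < e" and e: "\<And>y. dist (\<phi> u) y < e \<Longrightarrow> y \<in> U"
        using \<open>open U\<close> by (auto simp: open_dist dist_commute)
      have "Metric_space.mball (mspace ?P) (mdist ?P) \<phi> e \<subseteq> {\<phi> \<in> mspace ?P. \<phi> u \<in> U}"
      proof
        fix \<theta> assume \<theta>: "\<theta> \<in> Metric_space.mball (mspace ?P) (mdist ?P) \<phi> e"
        then have mem: "\<phi> \<in> mspace ?P" "\<theta> \<in> mspace ?P" "mdist ?P \<phi> \<theta> < e"
          by (simp_all add: Metric_space.in_mball[OF Metric_space_mspace_mdist])
        have "mdist euclidean_metric (\<phi> u) (\<theta> u) \<le> mdist ?P \<phi> \<theta>"
          unfolding path_space_def
          by (rule mdist_cfunspace_imp_mdist_le[OF mem(1,2)[unfolded path_space_def] order.refl])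
             (use u in simp)
        then show "\<theta> \<in> {\<phi> \<in> mspace ?P. \<phi> u \<in> U}"
          using mem e by simp
      qed
      with \<open>0 < e\<close> show "\<exists>r>0. Metric_space.mball (mspace ?P) (mdist ?P) \<phi> r
          \<subseteq> {\<phi> \<in> mspace ?P. \<phi> u \<in> U}" by blast
    qed auto
    moreover have sub: "{U. openin (mtopology_of ?P) U} \<subseteq> Pow (mspace ?P)"
      using openin_subset[of "mtopology_of ?P"] by auto
    moreover have "(\<lambda>\<phi>. \<phi> u) -` U \<inter> mspace ?P = {\<phi> \<in> mspace ?P. \<phi> u \<in> U}" by auto
    ultimately show "(\<lambda>\<phi>. \<phi> u) -` U \<inter> space (borel_paths t1 t2) \<in> sets (borel_paths t1 t2)"
      unfolding borel_paths_def space_measure_of[OF sub] sets_measure_of[OF sub]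
      by (auto intro: sigma_sets.Basic)
  qed
  from measurable_compose[OF _ this, of "\<lambda>\<omega>. \<lambda>u\<in>{t1..t2}. \<psi> u \<omega>" G] \<psi> u show ?thesis
    by (simp add: Lp_paths_def)
qed

text \<open>Follows from \<open>r^2 \<le> 1 + r powr p\<close> on a finite measure. This uniform
  bound later permits the passage to real-valued expectations.\<close>

lemma Lp_paths_mean_square_finite:
  assumes \<psi>: "\<psi> \<in> Lp_paths M G p t1 t2" and "2 \<le> p" "finite_measure M" "subalgebra M G"
  shows "(SUP u\<in>{t1..t2}. mean_square M (\<psi> u)) < \<infinity>"
proof -
  let ?S = "SUP u\<in>{t1..t2}. \<integral>\<^sup>+\<omega>. ennreal (norm (\<psi> u \<omega>) powr p) \<partial>M"
  have le: "r\<^sup>2 \<le> 1 + r powr p" if "0 \<le> r" for r :: real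
  proof (cases "r \<le> 1")
    case True
    then have "r\<^sup>2 \<le> 1" using that by (simp add: power_le_one)
    then show ?thesis by (simp add: add_increasing2)
  next
    case False
    then have "r powr 2 \<le> r powr p" using \<open>2 \<le> p\<close> by (intro powr_mono) auto
    then show ?thesis using False by simp
  qed
  have "mean_square M (\<psi> u) \<le> emeasure M (space M) + ?S" if "u \<in> {t1..t2}" for u
  proof -
    have "mean_square M (\<psi> u) \<le> (\<integral>\<^sup>+\<omega>. 1 + ennreal (norm (\<psi> u \<omega>) powr p) \<partial>M)"
      unfolding mean_square_def using le
      by (intro nn_integral_mono) (simp flip: ennreal_1 ennreal_plus)
    also have "\<dots> = emeasure M (space M) + (\<integral>\<^sup>+\<omega>. ennreal (norm (\<psi> u \<omega>) powr p) \<partial>M)"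
      using measurable_from_subalg[OF \<open>subalgebra M G\<close> Lp_paths_evaluation_measurable[OF \<psi> that]]
      by (subst nn_integral_add) auto
    also have "\<dots> \<le> emeasure M (space M) + ?S"
      using that by (intro add_left_mono SUP_upper)
    finally show ?thesis .
  qed
  then have "(SUP u\<in>{t1..t2}. mean_square M (\<psi> u)) \<le> emeasure M (space M) + ?S"
    by (rule SUP_least)
  also have "\<dots> < \<infinity>"
    using \<psi> finite_measure.emeasure_finite[OF \<open>finite_measure M\<close>]
    by (auto simp: Lp_paths_def less_top)
  finally show ?thesis .
qed

section \<open>Adapted variables and Wiener increments\<close>

lemma measurable_matrix_vector_mult[measurable (raw)]:
  fixes A :: "'w \<Rightarrow> complex ^ 'm ^ 'd"
  assumes "A \<in> borel_measurable M" "v \<in> borel_measurable M"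
  shows "(\<lambda>\<omega>. A \<omega> *v v \<omega>) \<in> borel_measurable M"
proof -
  have "continuous_on UNIV (\<lambda>(A :: complex ^ 'm ^ 'd, v). A *v v)"
    unfolding matrix_vector_mult_def case_prod_unfold
    by (intro continuous_on_vec_lambda continuous_intros)
  from borel_measurable_continuous_on[OF this, of "\<lambda>\<omega>. (A \<omega>, v \<omega>)"] assms
  show ?thesis by simp
qed

context stochastic_basis begin

lemma filtration_measurable_mono:
  assumes "a \<le> s" "s \<le> t" "Z \<in> F s \<rightarrow>\<^sub>M N"
  shows "Z \<in> F t \<rightarrow>\<^sub>M N"
proof -
  have "space (F s) = space (F t)"
    using assms filtration_subalgebra[of s] filtration_subalgebra[of t]
    by (auto simp: subalgebra_def)
  then have "subalgebra (F t) (F s)"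
    using assms filtration_mono by (simp add: subalgebra_def)
  then show ?thesis using assms(3) by (rule measurable_from_subalg)
qed

lemma filtration_measurable:
  assumes "a \<le> t" "Z \<in> F t \<rightarrow>\<^sub>M N"
  shows "Z \<in> M \<rightarrow>\<^sub>M N"
  by (rule measurable_from_subalg[OF filtration_subalgebra[OF assms(1)] assms(2)])

text \<open>Every subset of the exceptional null set lies in \<open>F t\<close>, by completeness and
  because \<open>F a\<close> contains the null sets. The scheme holds only almost surely, so
  adaptedness has to survive such changes.\<close>

lemma filtration_measurable_AE_cong:
  assumes "a \<le> t" and Z': "Z' \<in> F t \<rightarrow>\<^sub>M N" and AE: "AE \<omega> in M. Z \<omega> = Z' \<omega>"
    and Z: "Z \<in> space M \<rightarrow> space N"
  shows "Z \<in> F t \<rightarrow>\<^sub>M N"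
proof (rule measurableI)
  have sp: "space (F t) = space M"
    using filtration_subalgebra[OF \<open>a \<le> t\<close>] by (simp add: subalgebra_def)
  show "Z \<omega> \<in> space N" if "\<omega> \<in> space (F t)" for \<omega> using Z that sp by auto
  fix A assume A: "A \<in> sets N"
  obtain E where E: "{\<omega> \<in> space M. Z \<omega> \<noteq> Z' \<omega>} \<subseteq> E" "E \<in> null_sets M"
    using AE by (auto simp: eventually_ae_filter)
  have null: "E' \<in> sets (F t)" if "E' \<subseteq> E" for E'
    using complete2[OF that E(2)] filtration_null_sets filtration_mono[OF order.refl \<open>a \<le> t\<close>] by auto
  let ?E = "{\<omega> \<in> space M. Z \<omega> \<noteq> Z' \<omega>}"
  have "Z -` A \<inter> space (F t) = ((Z' -` A \<inter> space (F t)) - ?E) \<union> (Z -` A \<inter> ?E)"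
    using sp by auto
  moreover have "Z -` A \<inter> ?E \<in> sets (F t)" "?E \<in> sets (F t)"
    using E(1) by (auto intro!: null)
  ultimately show "Z -` A \<inter> space (F t) \<in> sets (F t)"
    using measurable_sets[OF Z' A] by auto
qed

end

section \<open>Moments of Wiener increments\<close>

context wiener_process begin

lemma increment_measurable:
  assumes "a \<le> s" "s < t"
  shows "(\<lambda>\<omega>. w t \<omega> - w s \<omega>) \<in> borel_measurable (F t)"
  using assms wiener_adapted[of t] filtration_measurable_mono[OF _ _ wiener_adapted[of s], of t]
  by simp

text \<open>Independence concerns families of events, and these only shrink: the events generated by
  \<open>Z\<close> lie in \<open>F s\<close>, and those generated by \<open>\<phi>\<close> of the
  increment are again preimages under the increment.\<close>

lemma indep_var_past_increment:
  fixes Z :: "'w \<Rightarrow> real"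
  assumes st: "a \<le> s" "s < t" and Z: "Z \<in> borel_measurable (F s)"
    and \<phi>: "\<phi> \<in> borel_measurable borel"
  shows "indep_var borel Z borel (\<lambda>\<omega>. \<phi> (w t \<omega> - w s \<omega>))"
proof -
  let ?\<Delta> = "\<lambda>\<omega>. w t \<omega> - w s \<omega>"
  let ?I = "{?\<Delta> -` B \<inter> space M | B. B \<in> sets borel}"
  have \<Delta>: "?\<Delta> \<in> borel_measurable M"
    using filtration_measurable[OF _ increment_measurable[OF st]] st by simp
  have sp: "space (F s) = space M"
    using filtration_subalgebra[of s] st by (simp add: subalgebra_def)
  have "sigma_sets (space M) {Z -` A \<inter> space M |A. A \<in> sets borel} \<subseteq> sets (F s)"
    using measurable_sets[OF Z] sp by (subst sp[symmetric], intro sets.sigma_sets_subset) auto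
  moreover have "sigma_sets (space M) {(\<lambda>\<omega>. \<phi> (?\<Delta> \<omega>)) -` A \<inter> space M |A. A \<in> sets borel} \<subseteq> ?I"
  proof -
    \<comment> \<open>The preimages under the increment already form a sigma-algebra, so it suffices
      to place the generators in it.\<close>
    have "{(\<lambda>\<omega>. \<phi> (?\<Delta> \<omega>)) -` A \<inter> space M |A. A \<in> sets borel} \<subseteq> sets (vimage_algebra (space M) ?\<Delta> borel)"
    proof clarify
      fix A :: "real set" assume "A \<in> sets borel"
      then have "\<phi> -` A \<in> sets borel" using measurable_sets[OF \<phi>, of A] by simp
      then show "(\<lambda>\<omega>. \<phi> (?\<Delta> \<omega>)) -` A \<inter> space M \<in> sets (vimage_algebra (space M) ?\<Delta> borel)"
        by (subst sets_vimage_algebra2) (auto intro!: exI[of _ "\<phi> -` A"])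
    qed
    from sets.sigma_sets_subset[OF this] show ?thesis
      by (simp add: sets_vimage_algebra2)
  qed
  moreover have "indep_set (sets (F s)) ?I" by (rule wiener_increment_indep_past[OF st])
  ultimately have "indep_set (sigma_sets (space M) {Z -` A \<inter> space M |A. A \<in> sets borel})
      (sigma_sets (space M) {(\<lambda>\<omega>. \<phi> (?\<Delta> \<omega>)) -` A \<inter> space M |A. A \<in> sets borel})"
    unfolding indep_set_def by (elim indep_sets_mono_sets) (auto split: bool.split)
  then show ?thesis
    unfolding indep_var_eq
    using filtration_measurable[OF st(1) Z] measurable_compose[OF \<Delta> \<phi>] by auto
qed

text \<open>Independence gives both integrability of the product and factorisation of its
  expectation; \<open>has_bochner_integral\<close> carries the two together, so that such terms can
  be summed.\<close>

lemma has_expectation_past_times_increment: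
  fixes Z :: "'w \<Rightarrow> real"
  assumes "a \<le> s" "s < t" "Z \<in> borel_measurable (F s)" "\<phi> \<in> borel_measurable borel"
    and Z: "integrable M Z" and \<phi>: "has_bochner_integral M (\<lambda>\<omega>. \<phi> (w t \<omega> - w s \<omega>)) m"
  shows "has_bochner_integral M (\<lambda>\<omega>. Z \<omega> * \<phi> (w t \<omega> - w s \<omega>)) (expectation Z * m)"
proof -
  note ind = indep_var_past_increment[OF assms(1-4)]
  have \<phi>i: "integrable M (\<lambda>\<omega>. \<phi> (w t \<omega> - w s \<omega>))" using \<phi> by (rule integrable.intros)
  show ?thesis
    using indep_var_integrable[OF ind Z \<phi>i] indep_var_lebesgue_integral[OF ind Z \<phi>i]
      has_bochner_integral_integral_eq[OF \<phi>]
    by (simp add: has_bochner_integral_iff)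
qed

lemma has_expectation_increment:
  assumes st: "a \<le> s" "s < t"
  shows "has_bochner_integral M (\<lambda>\<omega>. (w t \<omega> - w s \<omega>) $ j) 0"
proof -
  note D = wiener_increment_normal[OF st, of j]
  have "integrable M (\<lambda>\<omega>. (w t \<omega> - w s \<omega>) $ j)"
    using distributed_integrable[OF D, of "\<lambda>x. x"] st integrable_normal_moment_nz_1[of "sqrt (t - s)" 0]
    by simp
  moreover have "expectation (\<lambda>\<omega>. (w t \<omega> - w s \<omega>) $ j) = 0"
    using st by (intro normal_distributed_expectation[OF _ D]) simp
  ultimately show ?thesis by (simp add: has_bochner_integral_iff)
qed

text \<open>On the diagonal this is the normal variance, the mean being zero; off the diagonal,
  independence of the components leaves a product of vanishing means.\<close>

lemma has_expectation_increment_product: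
  assumes st: "a \<le> s" "s < t"
  shows "has_bochner_integral M (\<lambda>\<omega>. (w t \<omega> - w s \<omega>) $ j * (w t \<omega> - w s \<omega>) $ k)
           (if j = k then t - s else 0)"
proof (cases "j = k")
  case True
  note D = wiener_increment_normal[OF st, of j]
  have "integrable M (\<lambda>\<omega>. ((w t \<omega> - w s \<omega>) $ j)\<^sup>2)"
    using distributed_integrable[OF D, of "\<lambda>x. x\<^sup>2"] st integrable_normal_moment[of "sqrt (t - s)" 0 2]
    by simp
  moreover have "expectation (\<lambda>\<omega>. ((w t \<omega> - w s \<omega>) $ j)\<^sup>2) = t - s"
    using normal_distributed_variance[OF _ D] has_expectation_increment[OF st, of j] st
    by (simp add: has_bochner_integral_iff)
  ultimately show ?thesis using True by (simp add: has_bochner_integral_iff power2_eq_square)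
next
  case False
  let ?Y = "\<lambda>j \<omega>. (w t \<omega> - w s \<omega>) $ j"
  have ind: "indep_vars (\<lambda>_. borel) ?Y {j, k}"
    using indep_vars_subset[OF wiener_increment_indep_components[OF st]] by simp
  have int: "integrable M (?Y i)" "expectation (?Y i) = 0" for i
    using has_expectation_increment[OF st, of i] by (simp_all add: has_bochner_integral_iff)
  have "integrable M (\<lambda>\<omega>. \<Prod>i\<in>{j, k}. ?Y i \<omega>)"
    by (intro indep_vars_integrable ind int) auto
  moreover have "expectation (\<lambda>\<omega>. \<Prod>i\<in>{j, k}. ?Y i \<omega>) = (\<Prod>i\<in>{j, k}. expectation (?Y i))"
    by (intro indep_vars_lebesgue_integral ind int) auto
  ultimately show ?thesis
    using False int(2) by (simp add: has_bochner_integral_iff)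
qed

end

section \<open>Second moment of one noise step\<close>

lemma norm_matrix_square: "(norm (A :: complex ^ 'm ^ 'd))\<^sup>2 = (\<Sum>j\<in>UNIV. (norm (column j A))\<^sup>2)"
  by (simp add: norm_vec_def L2_set_def sum_nonneg column_def) (rule sum.swap)

text \<open>With the noise as a real combination of columns, its squared norm expands through the
  real inner product and the increments come out as scalar factors.\<close>

lemma matrix_vector_mult_of_real:
  fixes A :: "complex ^ 'm ^ 'd"
  shows "A *v (\<chi> j. complex_of_real (v $ j)) = (\<Sum>j\<in>UNIV. v $ j *\<^sub>R column j A)"
  by (simp add: vec_eq_iff matrix_vector_mult_def column_def)
     (simp add: scaleR_conv_of_real mult.commute)

lemma measurable_column[measurable (raw)]:
  assumes "A \<in> borel_measurable M"
  shows "(\<lambda>\<omega>. column j (A \<omega> :: complex ^ 'm ^ 'd)) \<in> borel_measurable M"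
proof -
  have "continuous_on UNIV (\<lambda>A :: complex ^ 'm ^ 'd. column j A)"
    unfolding column_def by (intro continuous_on_vec_lambda continuous_intros)
  from borel_measurable_continuous_on[OF this assms] show ?thesis .
qed

lemma integrable_inner_square_integrable:
  fixes x y :: "'w \<Rightarrow> 'v::euclidean_space"
  assumes [measurable]: "x \<in> borel_measurable M" "y \<in> borel_measurable M"
    and "integrable M (\<lambda>\<omega>. (norm (x \<omega>))\<^sup>2)" "integrable M (\<lambda>\<omega>. (norm (y \<omega>))\<^sup>2)"
  shows "integrable M (\<lambda>\<omega>. x \<omega> \<bullet> y \<omega>)"
proof (rule Bochner_Integration.integrable_bound)
  show "integrable M (\<lambda>\<omega>. (norm (x \<omega>))\<^sup>2 + (norm (y \<omega>))\<^sup>2)"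
    using assms by simp
  have "\<bar>u \<bullet> v\<bar> \<le> (norm u)\<^sup>2 + (norm v)\<^sup>2" for u v :: 'v
  proof -
    have "\<bar>u \<bullet> v\<bar> \<le> norm u * norm v" by (rule Cauchy_Schwarz_ineq2)
    also have "\<dots> \<le> (norm u)\<^sup>2 + (norm v)\<^sup>2"
    proof -
      have "2 * (norm u * norm v) \<le> (norm u)\<^sup>2 + (norm v)\<^sup>2"
        using sum_squares_bound[of "norm u" "norm v"] by (simp add: mult.assoc)
      moreover have "0 \<le> norm u * norm v" by simp
      ultimately show ?thesis by linarith
    qed
    finally show ?thesis .
  qed
  then show "AE \<omega> in M. norm (x \<omega> \<bullet> y \<omega>) \<le> norm ((norm (x \<omega>))\<^sup>2 + (norm (y \<omega>))\<^sup>2)"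
    by auto
qed simp

text \<open>The expanded square has coefficients known at time \<open>s\<close> times polynomials in
  the increment. The linear terms have mean zero; of the quadratic ones only the diagonal survives,
  and the squared column norms add up to the squared Frobenius norm.\<close>

lemma (in wiener_process) has_expectation_norm_square_noise_step:
  fixes D :: "'w \<Rightarrow> complex ^ 'd" and G :: "'w \<Rightarrow> complex ^ 'm ^ 'd"
  assumes st: "a \<le> s" "s < t"
    and DF[measurable]: "D \<in> borel_measurable (F s)" and GF[measurable]: "G \<in> borel_measurable (F s)"
    and D2: "integrable M (\<lambda>\<omega>. (norm (D \<omega>))\<^sup>2)" and G2: "integrable M (\<lambda>\<omega>. (norm (G \<omega>))\<^sup>2)"
  shows "has_bochner_integral M
           (\<lambda>\<omega>. (norm (D \<omega> + G \<omega> *v (\<chi> j. complex_of_real ((w t \<omega> - w s \<omega>) $ j))))\<^sup>2)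
           (expectation (\<lambda>\<omega>. (norm (D \<omega>))\<^sup>2) + (t - s) * expectation (\<lambda>\<omega>. (norm (G \<omega>))\<^sup>2))"
proof -
  note [measurable] = filtration_measurable[OF st(1) DF] filtration_measurable[OF st(1) GF]
  let ?\<Delta> = "\<lambda>j \<omega>. (w t \<omega> - w s \<omega>) $ j"
  let ?C = "\<lambda>j \<omega>. column j (G \<omega>)"
  have C2: "integrable M (\<lambda>\<omega>. (norm (?C j \<omega>))\<^sup>2)" for j
  proof (rule Bochner_Integration.integrable_bound[OF G2])
    have "(norm (?C j \<omega>))\<^sup>2 \<le> (norm (G \<omega>))\<^sup>2" for \<omega>
      unfolding norm_matrix_square by (rule member_le_sum) auto
    then show "AE \<omega> in M. norm ((norm (?C j \<omega>))\<^sup>2) \<le> norm ((norm (G \<omega>))\<^sup>2)"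
      by simp
  qed simp
  have expand: "(norm (D \<omega> + G \<omega> *v (\<chi> j. complex_of_real (?\<Delta> j \<omega>))))\<^sup>2 =
      (norm (D \<omega>))\<^sup>2 + (\<Sum>j\<in>UNIV. 2 * (D \<omega> \<bullet> ?C j \<omega>) * ?\<Delta> j \<omega>)
      + (\<Sum>j\<in>UNIV. \<Sum>k\<in>UNIV. (?C j \<omega> \<bullet> ?C k \<omega>) * (?\<Delta> j \<omega> * ?\<Delta> k \<omega>))" for \<omega>
    unfolding matrix_vector_mult_of_real power2_norm_eq_inner
    by (simp add: inner_add_left inner_add_right inner_sum_left inner_sum_right inner_commute
        sum_distrib_left algebra_simps)
  have "has_bochner_integral M (\<lambda>\<omega>. 2 * (D \<omega> \<bullet> ?C j \<omega>) * ?\<Delta> j \<omega>)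
          (expectation (\<lambda>\<omega>. 2 * (D \<omega> \<bullet> ?C j \<omega>)) * 0)" for j
    using has_expectation_increment[OF st]
    by (intro has_expectation_past_times_increment[OF st, where \<phi> = "\<lambda>x. x $ j"]
        integrable_mult_right integrable_inner_square_integrable D2 C2) auto
  moreover have "has_bochner_integral M (\<lambda>\<omega>. (?C j \<omega> \<bullet> ?C k \<omega>) * (?\<Delta> j \<omega> * ?\<Delta> k \<omega>))
          (expectation (\<lambda>\<omega>. ?C j \<omega> \<bullet> ?C k \<omega>) * (if j = k then t - s else 0))" for j k
    using has_expectation_increment_product[OF st]
    by (intro has_expectation_past_times_increment[OF st, where \<phi> = "\<lambda>x. x $ j * x $ k"]
        integrable_inner_square_integrable D2 C2) auto
  ultimately have "has_bochner_integral M
      (\<lambda>\<omega>. (norm (D \<omega> + G \<omega> *v (\<chi> j. complex_of_real (?\<Delta> j \<omega>))))\<^sup>2)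
      (expectation (\<lambda>\<omega>. (norm (D \<omega>))\<^sup>2)
       + (\<Sum>j\<in>UNIV. expectation (\<lambda>\<omega>. 2 * (D \<omega> \<bullet> ?C j \<omega>)) * 0)
       + (\<Sum>j\<in>UNIV. \<Sum>k\<in>UNIV. expectation (\<lambda>\<omega>. ?C j \<omega> \<bullet> ?C k \<omega>) * (if j = k then t - s else 0)))"
    unfolding expand
    by (intro has_bochner_integral_add has_bochner_integral_sum has_bochner_integral_integrable D2)
  moreover have "(\<Sum>j\<in>UNIV. \<Sum>k\<in>UNIV. expectation (\<lambda>\<omega>. ?C j \<omega> \<bullet> ?C k \<omega>) * (if j = k then t - s else 0))
      = (t - s) * expectation (\<lambda>\<omega>. (norm (G \<omega>))\<^sup>2)"
    by (simp add: norm_matrix_square C2 sum_distrib_left if_distrib power2_norm_eq_inner mult.commute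
        flip: power2_norm_eq_inner cong: if_cong)
  ultimately show ?thesis by simp
qed

section \<open>The backward Euler recursion\<close>

text \<open>The total weight stays a factor instead of being set to \<open>1\<close>: it is
  \<open>1\<close> for a full delayed argument, but \<open>1 - l\<close> once the share of the
  implicit unknown is split off.\<close>

lemma integral_convex_combination_le:
  fixes A :: "'w \<Rightarrow> real" and B :: "nat \<Rightarrow> 'w \<Rightarrow> real"
  assumes "0 \<le> u" "\<And>k. 0 \<le> v k"
    and A: "integrable M A" "integral\<^sup>L M A \<le> K"
    and B: "\<And>k. k \<le> n \<Longrightarrow> integrable M (B k)" "\<And>k. k \<le> n \<Longrightarrow> integral\<^sup>L M (B k) \<le> K"
  shows "integrable M (\<lambda>\<omega>. u * A \<omega> + (\<Sum>k\<le>n. v k * B k \<omega>))"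
    and "(\<integral>\<omega>. u * A \<omega> + (\<Sum>k\<le>n. v k * B k \<omega>) \<partial>M) \<le> (u + (\<Sum>k\<le>n. v k)) * K"
proof -
  have *: "has_bochner_integral M (\<lambda>\<omega>. u * A \<omega> + (\<Sum>k\<le>n. v k * B k \<omega>))
      (u * integral\<^sup>L M A + (\<Sum>k\<le>n. v k * integral\<^sup>L M (B k)))"
    using A(1) B(1)
    by (intro has_bochner_integral_add has_bochner_integral_sum has_bochner_integral_mult_right
        has_bochner_integral_integrable) auto
  then show "integrable M (\<lambda>\<omega>. u * A \<omega> + (\<Sum>k\<le>n. v k * B k \<omega>))" by (rule integrable.intros)
  have "(\<integral>\<omega>. u * A \<omega> + (\<Sum>k\<le>n. v k * B k \<omega>) \<partial>M)
      = u * integral\<^sup>L M A + (\<Sum>k\<le>n. v k * integral\<^sup>L M (B k))"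
    using * by (rule has_bochner_integral_integral_eq)
  also have "\<dots> \<le> u * K + (\<Sum>k\<le>n. v k * K)"
    using assms by (intro add_mono sum_mono mult_left_mono) auto
  finally show "(\<integral>\<omega>. u * A \<omega> + (\<Sum>k\<le>n. v k * B k \<omega>) \<partial>M) \<le> (u + (\<Sum>k\<le>n. v k)) * K"
    by (simp add: distrib_right sum_distrib_right)
qed

text \<open>\<open>step_small\<close> says \<open>Q > 0\<close>. Both cases supply it:
  \<open>Q = P - h * c \<ge> 1 - c0\<close> when \<open>c > 0\<close>, and
  \<open>Q \<ge> P > 0\<close> when \<open>c \<le> 0\<close>.\<close>

locale backward_euler_problem = wiener_process M F a w
  for M :: "'w measure" and F :: "real \<Rightarrow> 'w measure" and a :: real
    and w :: "real \<Rightarrow> 'w \<Rightarrow> real ^ 'm" +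
  fixes b \<tau>0 \<alpha> \<beta> \<gamma>1 \<gamma>2 h :: real and \<tau> :: "real \<Rightarrow> real"
    and f :: "real \<Rightarrow> complex ^ 'd \<Rightarrow> complex ^ 'd \<Rightarrow> complex ^ 'd"
    and g :: "real \<Rightarrow> complex ^ 'd \<Rightarrow> complex ^ 'd \<Rightarrow> complex ^ 'm ^ 'd"
    and N :: nat
  assumes problem: "delay_problem a b \<tau>0 \<tau> f g"
    and SD: "SD \<alpha> \<beta> \<gamma>1 \<gamma>2 a b f g"
    and N_pos: "0 < N" and h_eq: "h = (b - a) / real N"
    and step_small: "2 * h * \<alpha> + 2 * h * \<beta> < 1"
begin

section \<open>Grid, coefficient bounds and delayed arguments\<close>

abbreviation delayed :: "(real \<Rightarrow> 'w \<Rightarrow> complex ^ 'd) \<Rightarrow> (nat \<Rightarrow> 'w \<Rightarrow> complex ^ 'd)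
    \<Rightarrow> nat \<Rightarrow> 'w \<Rightarrow> complex ^ 'd" where
  "delayed \<psi> X n \<omega> \<equiv>
     interpolant a h (\<lambda>t. \<psi> t \<omega>) (\<lambda>k. X k \<omega>) (grid a h n - \<tau> (grid a h n))"

abbreviation noise :: "nat \<Rightarrow> 'w \<Rightarrow> complex ^ 'm" where
  "noise n \<omega> \<equiv> \<chi> j. complex_of_real ((w (grid a h (Suc n)) \<omega> - w (grid a h n) \<omega>) $ j)"

lemma h_pos: "0 < h"
  using problem N_pos by (simp add: delay_problem_def h_eq)

lemma grid_mono: "m \<le> n \<Longrightarrow> grid a h m \<le> grid a h n"
  using h_pos by (simp add: grid_def)

lemma grid_ge: "a \<le> grid a h n"
  using h_pos by (simp add: grid_def)

lemma grid_Suc: "grid a h (Suc n) = grid a h n + h"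
  by (simp add: grid_def algebra_simps)

lemma grid_in_interval: "n \<le> N \<Longrightarrow> grid a h n \<in> {a..b}"
proof -
  assume "n \<le> N"
  moreover have "grid a h N = b" using N_pos by (simp add: grid_def h_eq)
  ultimately show ?thesis using grid_mono[of n N] grid_ge[of n] by simp
qed

text \<open>The constants are arbitrary reals, but testing the Lipschitz conditions on a unit vector
  against \<open>0\<close> bounds each of them below by a norm.\<close>

lemma coefficients_nonneg: "0 \<le> \<beta>" "0 \<le> \<gamma>1" "0 \<le> \<gamma>2"
proof -
  obtain x :: "complex ^ 'd" where x: "norm x = 1"
    using vector_choose_size[of 1] by auto
  have "a \<in> {a..b}" using problem by (simp add: delay_problem_def)
  with SD have "norm (f a 0 x - f a 0 0) \<le> \<beta> * norm (x - 0)"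
    "norm (g a x 0 - g a 0 0) \<le> \<gamma>1 * norm (x - 0) + \<gamma>2 * norm (0 - 0 :: complex ^ 'd)"
    "norm (g a 0 x - g a 0 0) \<le> \<gamma>1 * norm (0 - 0 :: complex ^ 'd) + \<gamma>2 * norm (x - 0)"
    unfolding SD_def by blast+
  then show "0 \<le> \<beta>" "0 \<le> \<gamma>1" "0 \<le> \<gamma>2"
    using x by (auto intro: order_trans[OF norm_ge_zero])
qed

text \<open>Inserting \<open>f t x2 y1\<close> splits the difference: the one-sided condition treats
  the change in \<open>x\<close>, Cauchy-Schwarz and the Lipschitz condition the change in
  \<open>y\<close>.\<close>

lemma drift_one_sided_bound:
  assumes t: "t \<in> {a..b}"
  shows "(x1 - x2) \<bullet> (f t x1 y1 - f t x2 y2)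
    \<le> \<alpha> * (norm (x1 - x2))\<^sup>2 + \<beta> * (norm (x1 - x2) * norm (y1 - y2))"
proof -
  have "(x1 - x2) \<bullet> (f t x1 y1 - f t x2 y1) \<le> \<alpha> * (norm (x1 - x2))\<^sup>2"
    using SD t unfolding SD_def Re_hermitian_inner[symmetric] by blast
  moreover have "(x1 - x2) \<bullet> (f t x2 y1 - f t x2 y2) \<le> norm (x1 - x2) * (\<beta> * norm (y1 - y2))"
  proof -
    have "norm (f t x2 y1 - f t x2 y2) \<le> \<beta> * norm (y1 - y2)"
      using SD t unfolding SD_def by blast
    then show ?thesis
      by (meson norm_cauchy_schwarz mult_left_mono norm_ge_zero order_trans)
  qed
  moreover have "f t x1 y1 - f t x2 y2 = (f t x1 y1 - f t x2 y1) + (f t x2 y1 - f t x2 y2)" by simp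
  ultimately show ?thesis by (simp only: inner_add_right) (simp add: mult_ac)
qed

text \<open>The mixed term of the square is shared equally between the two squared norms, at the
  cost of a discarded square. The two coefficients add up to
  \<open>(\<gamma>1 + \<gamma>2)^2\<close>.\<close>

lemma diffusion_square_bound:
  assumes t: "t \<in> {a..b}"
  shows "(norm (g t x1 y1 - g t x2 y2))\<^sup>2
    \<le> (\<gamma>1\<^sup>2 + \<gamma>1 * \<gamma>2) * (norm (x1 - x2))\<^sup>2 + (\<gamma>1 * \<gamma>2 + \<gamma>2\<^sup>2) * (norm (y1 - y2))\<^sup>2"
proof -
  let ?p = "norm (x1 - x2)" and ?q = "norm (y1 - y2)"
  have "norm (g t x1 y1 - g t x2 y2) \<le> \<gamma>1 * ?p + \<gamma>2 * ?q"
    using SD t unfolding SD_def by blast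
  then have "(norm (g t x1 y1 - g t x2 y2))\<^sup>2 \<le> (\<gamma>1 * ?p + \<gamma>2 * ?q)\<^sup>2"
    by (rule power_mono) simp
  also have "\<dots> = (\<gamma>1\<^sup>2 + \<gamma>1 * \<gamma>2) * ?p\<^sup>2 + (\<gamma>1 * \<gamma>2 + \<gamma>2\<^sup>2) * ?q\<^sup>2
      - \<gamma>1 * \<gamma>2 * (?p - ?q)\<^sup>2"
    by (simp add: power2_eq_square algebra_simps)
  also have "\<dots> \<le> (\<gamma>1\<^sup>2 + \<gamma>1 * \<gamma>2) * ?p\<^sup>2 + (\<gamma>1 * \<gamma>2 + \<gamma>2\<^sup>2) * ?q\<^sup>2"
    using coefficients_nonneg by simp
  finally show ?thesis .
qed

text \<open>The delay is deterministic, so one choice of \<open>s\<close>, \<open>u\<close>,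
  \<open>v\<close> depending only on \<open>n\<close> serves all processes and all outcomes; this is
  what makes differences and measurability easy to handle.\<close>

lemma delay_weights:
  assumes "n \<le> N"
  obtains s u v where "s \<in> {a - \<tau>0..a}" "0 \<le> u" "\<And>k. 0 \<le> v k" "u + (\<Sum>k\<le>n. v k) = 1"
    "\<And>\<psi> X \<omega>. delayed \<psi> X n \<omega> = u *\<^sub>R \<psi> s \<omega> + (\<Sum>k\<le>n. v k *\<^sub>R X k \<omega>)"
proof -
  let ?t = "grid a h n - \<tau> (grid a h n)"
  have t: "?t \<le> grid a h n" "a - \<tau>0 \<le> ?t" "0 \<le> \<tau>0"
    using problem grid_in_interval[OF assms] by (auto simp: delay_problem_def)
  obtain u v where uv: "0 \<le> u" "\<And>k. 0 \<le> v k" "u + (\<Sum>k\<le>n. v k) = 1"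
    "\<And>\<xi> (X :: nat \<Rightarrow> complex ^ 'd).
       interpolant a h \<xi> X ?t = u *\<^sub>R \<xi> (min ?t a) + (\<Sum>k\<le>n. v k *\<^sub>R X k)"
    by (rule interpolant_convex_combination[OF h_pos t(1)]) (rule that)
  show ?thesis
  proof (rule that[of "min ?t a" u v])
    show "delayed \<psi> X n \<omega> = u *\<^sub>R \<psi> (min ?t a) \<omega> + (\<Sum>k\<le>n. v k *\<^sub>R X k \<omega>)"
      for \<psi> X \<omega> by (rule uv(4))
  qed (use t uv(1-3) in auto)
qed

lemma delayed_diff:
  assumes "n \<le> N"
  shows "delayed \<psi> X n \<omega> - delayed \<phi> Y n \<omega>
       = delayed (\<lambda>t \<omega>. \<psi> t \<omega> - \<phi> t \<omega>) (\<lambda>k \<omega>. X k \<omega> - Y k \<omega>) n \<omega>"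
proof -
  obtain s u v where s: "s \<in> {a - \<tau>0..a}" and uv: "0 \<le> u" "\<And>k. 0 \<le> v k" "u + (\<Sum>k\<le>n. v k) = 1"
    and *: "\<And>\<theta> Z \<rho>. delayed \<theta> Z n \<rho> = u *\<^sub>R \<theta> s \<rho> + (\<Sum>k\<le>n. v k *\<^sub>R Z k \<rho>)"
    by (rule delay_weights[OF assms]) (rule that)
  show ?thesis
    using *[of \<psi> \<omega> X] *[of \<phi> \<omega> Y]
      *[of "\<lambda>t \<omega>. \<psi> t \<omega> - \<phi> t \<omega>" \<omega> "\<lambda>k \<omega>. X k \<omega> - Y k \<omega>"]
    by (simp add: scaleR_diff_right sum_subtractf)
qed

lemma delayed_measurable:
  assumes "n \<le> N" and "\<And>s. s \<in> {a - \<tau>0..a} \<Longrightarrow> \<psi> s \<in> borel_measurable (F a)"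
    and "\<And>k. k \<le> n \<Longrightarrow> X k \<in> borel_measurable (F (grid a h n))"
  shows "delayed \<psi> X n \<in> borel_measurable (F (grid a h n))"
proof -
  obtain s u v where s: "s \<in> {a - \<tau>0..a}" and uv: "0 \<le> u" "\<And>k. 0 \<le> v k" "u + (\<Sum>k\<le>n. v k) = 1"
    and *: "\<And>\<psi> X \<omega>. delayed \<psi> X n \<omega> = u *\<^sub>R \<psi> s \<omega> + (\<Sum>k\<le>n. v k *\<^sub>R X k \<omega>)"
    by (rule delay_weights[OF assms(1)]) (rule that)
  have "\<psi> s \<in> borel_measurable (F (grid a h n))"
    by (rule filtration_measurable_mono[OF order.refl grid_ge assms(2)[OF s]])
  then show ?thesis
    unfolding * using assms(3)
    by (intro borel_measurable_add borel_measurable_scaleR borel_measurable_sum borel_measurable_const) auto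
qed

section \<open>Adaptedness of the numerical solution\<close>

lemma drift_continuous:
  assumes "t \<in> {a..b}"
  shows "continuous_on UNIV (\<lambda>(x, y). f t x y)"
proof -
  have "continuous_on ({a..b} \<times> UNIV \<times> UNIV) (\<lambda>(t, x, y). f t x y)"
    using problem by (simp add: delay_problem_def)
  from continuous_on_compose2[OF this, of UNIV "\<lambda>p. (t, fst p, snd p)"] assms show ?thesis
    by (simp add: case_prod_unfold continuous_intros image_subset_iff)
qed

lemma diffusion_measurable:
  assumes "t \<in> {a..b}" "Z \<in> borel_measurable A" "Z' \<in> borel_measurable A"
  shows "(\<lambda>\<omega>. g t (Z \<omega>) (Z' \<omega>)) \<in> borel_measurable A"
proof -
  have "continuous_on ({a..b} \<times> UNIV \<times> UNIV) (\<lambda>(t, x, y). g t x y)"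
    using problem by (simp add: delay_problem_def)
  from continuous_on_compose2[OF this, of UNIV "\<lambda>p. (t, fst p, snd p)"] assms(1)
  have "continuous_on UNIV (\<lambda>(x, y). g t x y)"
    by (simp add: case_prod_unfold continuous_intros image_subset_iff)
  from borel_measurable_continuous_on[OF this, of "\<lambda>\<omega>. (Z \<omega>, Z' \<omega>)"] assms(2,3)
  show ?thesis by simp
qed

lemma noise_measurable: "noise n \<in> borel_measurable (F (grid a h (Suc n)))"
proof -
  have "continuous_on UNIV (\<lambda>x :: real ^ 'm. \<chi> j. complex_of_real (x $ j))"
    by (intro continuous_on_vec_lambda continuous_intros)
  from borel_measurable_continuous_on[OF this increment_measurable[OF grid_ge[of n]]] h_pos
  show ?thesis by (simp add: grid_Suc)
qed

lemma backward_euler_AE: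
  assumes "backward_euler M w a h N \<tau> f g \<psi> X"
  shows "AE \<omega> in M. X 0 \<omega> = \<psi> a \<omega>"
    and "n < N \<Longrightarrow> AE \<omega> in M. X (Suc n) \<omega> = X n \<omega>
      + h *\<^sub>R f (grid a h (Suc n)) (X (Suc n) \<omega>) (delayed \<psi> X (Suc n) \<omega>)
      + g (grid a h n) (X n \<omega>) (delayed \<psi> X n \<omega>) *v noise n \<omega>"
  using assms unfolding backward_euler_def Let_def by (auto elim!: AE_mp)

text \<open>A delay shorter than a step lets the unknown enter its own delayed argument with weight
  \<open>l\<close>, hence \<open>H + l x\<close>. The inner product of the difference of the two
  values with \<open>x - y\<close> is at least the constant times the squared norm; Cauchy-Schwarz
  and cancellation finish.\<close>

lemma implicit_step_expanding:
  assumes t: "t \<in> {a..b}" and l: "0 \<le> l" "l \<le> 1"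
  shows "(1 - h * (\<alpha> + \<beta>)) * norm (x - y)
    \<le> norm ((x - h *\<^sub>R f t x (H + l *\<^sub>R x) - r) - (y - h *\<^sub>R f t y (H + l *\<^sub>R y) - r))"
    (is "?\<kappa> * _ \<le> norm ?d")
proof (cases "x = y")
  case False
  let ?n = "norm (x - y)"
  have "(x - y) \<bullet> (f t x (H + l *\<^sub>R x) - f t y (H + l *\<^sub>R y))
      \<le> \<alpha> * ?n\<^sup>2 + \<beta> * (?n * norm (l *\<^sub>R (x - y)))"
    using drift_one_sided_bound[OF t, of x y "H + l *\<^sub>R x" "H + l *\<^sub>R y"]
    by (simp add: scaleR_diff_right)
  also have "\<dots> \<le> (\<alpha> + \<beta>) * ?n\<^sup>2"
  proof -
    have "norm (l *\<^sub>R (x - y)) \<le> ?n"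
      using l by (simp add: mult_left_le_one_le)
    then have "\<beta> * (?n * norm (l *\<^sub>R (x - y))) \<le> \<beta> * (?n * ?n)"
      using coefficients_nonneg by (intro mult_left_mono) auto
    then show ?thesis by (simp add: power2_eq_square distrib_right)
  qed
  finally have *: "h * ((x - y) \<bullet> (f t x (H + l *\<^sub>R x) - f t y (H + l *\<^sub>R y))) \<le> h * ((\<alpha> + \<beta>) * ?n\<^sup>2)"
    using h_pos by simp
  have "?\<kappa> * ?n\<^sup>2 \<le> ?n\<^sup>2 - h * ((x - y) \<bullet> (f t x (H + l *\<^sub>R x) - f t y (H + l *\<^sub>R y)))"
    using * by (simp add: algebra_simps)
  also have "\<dots> = (x - y) \<bullet> ?d"
  proof -
    have "?d = (x - y) - h *\<^sub>R (f t x (H + l *\<^sub>R x) - f t y (H + l *\<^sub>R y))"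
      by (simp add: scaleR_diff_right)
    then show ?thesis by (simp only: inner_diff_right inner_scaleR_right power2_norm_eq_inner)
  qed
  also have "\<dots> \<le> ?n * norm ?d" by (rule norm_cauchy_schwarz)
  finally have "?n * (?\<kappa> * ?n) \<le> ?n * norm ?d" by (simp add: power2_eq_square mult_ac)
  then show ?thesis by (rule mult_left_le_imp_le) (use False in simp)
qed simp

text \<open>By induction, each new value is almost surely a Borel function of data already
  measurable at the new time. All \<open>k \<le> n\<close> are treated together because the delayed
  arguments reach back arbitrarily far.\<close>

lemma backward_euler_adapted:
  assumes be: "backward_euler M w a h N \<tau> f g \<psi> X"
    and hist: "\<And>s. s \<in> {a - \<tau>0..a} \<Longrightarrow> \<psi> s \<in> borel_measurable (F a)"
    and "n \<le> N" "k \<le> n"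
  shows "X k \<in> borel_measurable (F (grid a h n))"
  using assms(3,4)
proof (induction n arbitrary: k)
  case 0
  have "0 \<le> \<tau>0" using problem by (simp add: delay_problem_def)
  then have "\<psi> a \<in> borel_measurable (F (grid a h 0))" using hist[of a] by (simp add: grid_def)
  from filtration_measurable_AE_cong[OF grid_ge this backward_euler_AE(1)[OF be]] 0
  show ?case by simp
next
  case (Suc n)
  let ?F = "F (grid a h (Suc n))"
  have n: "n \<le> N" "n < N" using Suc.prems by auto
  have past: "X k \<in> borel_measurable (F (grid a h n))" if "k \<le> n" for k
    using Suc.IH[OF n(1) that] .
  note lift = filtration_measurable_mono[OF grid_ge grid_mono[of n "Suc n"]]
  have past': "X k \<in> borel_measurable ?F" if "k \<le> n" for k
    using lift[OF _ past[OF that]] by simp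
  obtain s u v where s: "s \<in> {a - \<tau>0..a}" and uv: "0 \<le> u" "\<And>k. 0 \<le> v k" "u + (\<Sum>k\<le>Suc n. v k) = 1"
    and del: "\<And>\<psi> X \<omega>. delayed \<psi> X (Suc n) \<omega> = u *\<^sub>R \<psi> s \<omega> + (\<Sum>k\<le>Suc n. v k *\<^sub>R X k \<omega>)"
    by (rule delay_weights[OF Suc.prems(1)]) (rule that)
  \<comment> \<open>The delayed argument is split into a known part \<open>H\<close> and the share
    \<open>l\<close> of the unknown.\<close>
  define l where "l = v (Suc n)"
  have l: "0 \<le> l" "l \<le> 1"
    using uv sum_nonneg[of "{..n}" v] by (auto simp: l_def)
  define H where "H \<omega> = u *\<^sub>R \<psi> s \<omega> + (\<Sum>k\<le>n. v k *\<^sub>R X k \<omega>)" for \<omega>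
  define r where "r \<omega> = X n \<omega> + g (grid a h n) (X n \<omega>) (delayed \<psi> X n \<omega>) *v noise n \<omega>" for \<omega>
  have H: "H \<in> borel_measurable ?F"
    unfolding H_def using past' filtration_measurable_mono[OF order.refl grid_ge hist[OF s]]
    by (intro borel_measurable_add borel_measurable_scaleR borel_measurable_sum borel_measurable_const) auto
  have "(\<lambda>\<omega>. g (grid a h n) (X n \<omega>) (delayed \<psi> X n \<omega>)) \<in> borel_measurable ?F"
    using lift[OF _ diffusion_measurable[OF grid_in_interval[OF n(1)] past[OF order.refl]
        delayed_measurable[OF n(1) hist past]]] by simp
  then have r: "r \<in> borel_measurable ?F"
    unfolding r_def using past' noise_measurable
    by (intro borel_measurable_add measurable_matrix_vector_mult) auto
  \<comment> \<open>The parameter is the pair \<open>(H, r)\<close> of known delayed part and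
    explicit right-hand side; zeros of \<open>\<Phi>\<close> are the solutions of the implicit
    step.\<close>
  define \<Phi> where "\<Phi> p x = x - h *\<^sub>R f (grid a h (Suc n)) x (fst p + l *\<^sub>R x) - snd p"
    for p :: "(complex ^ 'd) \<times> (complex ^ 'd)" and x
  let ?G = "\<lambda>q :: ((complex ^ 'd) \<times> (complex ^ 'd)) \<times> (complex ^ 'd). (snd q, fst (fst q) + l *\<^sub>R snd q)"
  have "continuous_on UNIV (\<lambda>q. (case ?G q of (x, y) \<Rightarrow> f (grid a h (Suc n)) x y))"
    by (rule continuous_on_compose2[OF drift_continuous[OF grid_in_interval[OF Suc.prems(1)]]])
       (auto intro!: continuous_intros)
  then have "continuous_on UNIV (\<lambda>(p, x). \<Phi> p x)"
    unfolding \<Phi>_def case_prod_unfold fst_conv snd_conv by (intro continuous_intros)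
  moreover have "0 < 1 - h * (\<alpha> + \<beta>)" using step_small by (simp add: algebra_simps)
  moreover have "(1 - h * (\<alpha> + \<beta>)) * norm (x - y) \<le> norm (\<Phi> p x - \<Phi> p y)" for p x y
    unfolding \<Phi>_def by (rule implicit_step_expanding[OF grid_in_interval[OF Suc.prems(1)] l])
  ultimately obtain S where S: "S \<in> borel_measurable borel" "\<And>p x. \<Phi> p x = 0 \<Longrightarrow> x = S p"
    by (rule borel_implicit_solution) (rule that)
  have "(\<lambda>\<omega>. S (H \<omega>, r \<omega>)) \<in> borel_measurable ?F"
    using measurable_compose[OF measurable_Pair[OF H r], of S borel] S(1)
    by (simp add: borel_prod)
  moreover have "AE \<omega> in M. X (Suc n) \<omega> = S (H \<omega>, r \<omega>)"
    using backward_euler_AE(2)[OF be n(2)]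
  proof eventually_elim
    fix \<omega>
    assume *: "X (Suc n) \<omega> = X n \<omega>
      + h *\<^sub>R f (grid a h (Suc n)) (X (Suc n) \<omega>) (delayed \<psi> X (Suc n) \<omega>)
      + g (grid a h n) (X n \<omega>) (delayed \<psi> X n \<omega>) *v noise n \<omega>"
    have "delayed \<psi> X (Suc n) \<omega> = H \<omega> + l *\<^sub>R X (Suc n) \<omega>"
      by (simp only: del H_def l_def sum.atMost_Suc add.assoc)
    then have "\<Phi> (H \<omega>, r \<omega>) (X (Suc n) \<omega>) = 0"
      using * by (simp add: \<Phi>_def r_def algebra_simps)
    then show "X (Suc n) \<omega> = S (H \<omega>, r \<omega>)" by (rule S(2))
  qed
  ultimately have "X (Suc n) \<in> borel_measurable ?F"
    by (rule filtration_measurable_AE_cong[OF grid_ge]) simp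
  then show ?case using past' Suc.prems(2) le_Suc_eq by blast
qed


section \<open>Mean-square estimate of the difference of two solutions\<close>

text \<open>Expand the last square and drop its term of order \<open>h^2\<close>. The product of the
  two norms in the drift bound is split by Young's inequality, which puts one
  \<open>h * \<beta>\<close> on each side.\<close>

lemma implicit_step_square_bound:
  assumes t: "t \<in> {a..b}"
  shows "(1 - 2 * h * \<alpha> - h * \<beta>) * (norm (x1 - x2))\<^sup>2
    \<le> h * \<beta> * (norm (y1 - y2))\<^sup>2 + (norm ((x1 - x2) - h *\<^sub>R (f t x1 y1 - f t x2 y2)))\<^sup>2"
proof -
  let ?\<delta> = "f t x1 y1 - f t x2 y2"
  define p q i where "p = norm (x1 - x2)" and "q = norm (y1 - y2)" and "i = (x1 - x2) \<bullet> ?\<delta>"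
  have "i \<le> \<alpha> * p\<^sup>2 + \<beta> * (p * q)"
    unfolding p_def q_def i_def by (rule drift_one_sided_bound[OF t])
  also have "\<beta> * (p * q) \<le> \<beta> * ((p\<^sup>2 + q\<^sup>2) / 2)"
    using coefficients_nonneg sum_squares_bound[of p q] by (intro mult_left_mono) auto
  finally have "2 * h * i \<le> 2 * h * (\<alpha> * p\<^sup>2 + \<beta> * ((p\<^sup>2 + q\<^sup>2) / 2))"
    using h_pos by simp
  then have "(1 - 2 * h * \<alpha> - h * \<beta>) * p\<^sup>2 \<le> h * \<beta> * q\<^sup>2 + (p\<^sup>2 - 2 * h * i)"
    by (simp add: field_simps)
  also have "p\<^sup>2 - 2 * h * i \<le> (norm ((x1 - x2) - h *\<^sub>R ?\<delta>))\<^sup>2"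
  proof -
    have "(norm (x - h *\<^sub>R y))\<^sup>2 = (norm x)\<^sup>2 - 2 * h * (x \<bullet> y) + h\<^sup>2 * (norm y)\<^sup>2" for x y :: "complex ^ 'd"
      unfolding power2_norm_eq_inner
      by (simp add: inner_diff_left inner_diff_right inner_commute[of y x] power2_eq_square algebra_simps)
    then show ?thesis by (simp add: p_def i_def)
  qed
  finally show ?thesis unfolding p_def q_def by simp
qed

text \<open>Pointwise convexity of the squared norm, with weights of total \<open>1\<close>,
  preserves a common bound \<open>K\<close>.\<close>

lemma delayed_mean_square:
  assumes "n \<le> N"
    and hist: "\<And>s. s \<in> {a - \<tau>0..a} \<Longrightarrow> integrable M (\<lambda>\<omega>. (norm (\<psi> s \<omega>))\<^sup>2)"
      "\<And>s. s \<in> {a - \<tau>0..a} \<Longrightarrow> expectation (\<lambda>\<omega>. (norm (\<psi> s \<omega>))\<^sup>2) \<le> K"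
    and past: "\<And>k. k \<le> n \<Longrightarrow> integrable M (\<lambda>\<omega>. (norm (X k \<omega>))\<^sup>2)"
      "\<And>k. k \<le> n \<Longrightarrow> expectation (\<lambda>\<omega>. (norm (X k \<omega>))\<^sup>2) \<le> K"
    and meas: "delayed \<psi> X n \<in> borel_measurable M"
  shows "integrable M (\<lambda>\<omega>. (norm (delayed \<psi> X n \<omega>))\<^sup>2)"
    and "expectation (\<lambda>\<omega>. (norm (delayed \<psi> X n \<omega>))\<^sup>2) \<le> K"
proof -
  obtain s u v where s: "s \<in> {a - \<tau>0..a}" and uv: "0 \<le> u" "\<And>k. 0 \<le> v k" "u + (\<Sum>k\<le>n. v k) = 1"
    and *: "\<And>\<psi> X \<omega>. delayed \<psi> X n \<omega> = u *\<^sub>R \<psi> s \<omega> + (\<Sum>k\<le>n. v k *\<^sub>R X k \<omega>)"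
    by (rule delay_weights[OF assms(1)]) (rule that)
  let ?B = "\<lambda>\<omega>. u * (norm (\<psi> s \<omega>))\<^sup>2 + (\<Sum>k\<le>n. v k * (norm (X k \<omega>))\<^sup>2)"
  have B: "integrable M ?B" "expectation ?B \<le> (u + (\<Sum>k\<le>n. v k)) * K"
    by (rule integral_convex_combination_le[OF uv(1,2) hist(1)[OF s] hist(2)[OF s] past]; assumption)+
  have le: "(norm (delayed \<psi> X n \<omega>))\<^sup>2 \<le> ?B \<omega>" for \<omega>
    unfolding * by (rule norm_convex_combination_square_le[OF uv])
  show int: "integrable M (\<lambda>\<omega>. (norm (delayed \<psi> X n \<omega>))\<^sup>2)"
  proof (rule Bochner_Integration.integrable_bound[OF B(1)])
    show "AE \<omega> in M. norm ((norm (delayed \<psi> X n \<omega>))\<^sup>2) \<le> norm (?B \<omega>)"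
      using le by (intro AE_I2) (auto intro: order_trans[OF _ abs_ge_self])
  qed (use meas in measurable)
  have "expectation (\<lambda>\<omega>. (norm (delayed \<psi> X n \<omega>))\<^sup>2) \<le> expectation ?B"
    by (rule integral_mono[OF int B(1) le])
  also have "\<dots> \<le> K" using B(2) uv(3) by simp
  finally show "expectation (\<lambda>\<omega>. (norm (delayed \<psi> X n \<omega>))\<^sup>2) \<le> K" .
qed

text \<open>The factor \<open>r\<close> multiplies a bound for the whole past and the history, not
  just for the previous value, because the delayed arguments may reach any of them.\<close>

lemma difference_step:
  fixes \<psi> \<phi> :: "real \<Rightarrow> 'w \<Rightarrow> complex ^ 'd" and X Y :: "nat \<Rightarrow> 'w \<Rightarrow> complex ^ 'd"
  defines "\<delta> \<equiv> \<lambda>t \<omega>. \<psi> t \<omega> - \<phi> t \<omega>" and "D \<equiv> \<lambda>k \<omega>. X k \<omega> - Y k \<omega>"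
  assumes X: "backward_euler M w a h N \<tau> f g \<psi> X" and Y: "backward_euler M w a h N \<tau> f g \<phi> Y"
    and \<psi>: "\<And>s. s \<in> {a - \<tau>0..a} \<Longrightarrow> \<psi> s \<in> borel_measurable (F a)"
    and \<phi>: "\<And>s. s \<in> {a - \<tau>0..a} \<Longrightarrow> \<phi> s \<in> borel_measurable (F a)"
    and n: "n < N"
    and hist: "\<And>s. s \<in> {a - \<tau>0..a} \<Longrightarrow> integrable M (\<lambda>\<omega>. (norm (\<delta> s \<omega>))\<^sup>2)"
      "\<And>s. s \<in> {a - \<tau>0..a} \<Longrightarrow> expectation (\<lambda>\<omega>. (norm (\<delta> s \<omega>))\<^sup>2) \<le> K"
    and past: "\<And>k. k \<le> n \<Longrightarrow> integrable M (\<lambda>\<omega>. (norm (D k \<omega>))\<^sup>2)"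
      "\<And>k. k \<le> n \<Longrightarrow> expectation (\<lambda>\<omega>. (norm (D k \<omega>))\<^sup>2) \<le> K"
    and r: "1 \<le> r" "1 + h * (\<gamma>1 + \<gamma>2)\<^sup>2 \<le> r * (1 - 2 * h * \<alpha> - 2 * h * \<beta>)"
  shows "integrable M (\<lambda>\<omega>. (norm (D (Suc n) \<omega>))\<^sup>2)"
    and "expectation (\<lambda>\<omega>. (norm (D (Suc n) \<omega>))\<^sup>2) \<le> r * K"
proof -
  let ?t = "grid a h n" and ?t' = "grid a h (Suc n)"
  have nN: "n \<le> N" "Suc n \<le> N" using n by auto
  note XF = backward_euler_adapted[OF X \<psi>] and YF = backward_euler_adapted[OF Y \<phi>]
  have \<delta>F: "\<delta> s \<in> borel_measurable (F a)" if "s \<in> {a - \<tau>0..a}" for s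
    unfolding \<delta>_def using \<psi>[OF that] \<phi>[OF that] by simp
  have DF: "D k \<in> borel_measurable (F (grid a h m))" if "m \<le> N" "k \<le> m" for k m
    unfolding D_def using XF[OF _ that] YF[OF _ that] by simp
  have delF: "delayed \<delta> D m \<in> borel_measurable (F (grid a h m))" if "m \<le> N" for m
    using delayed_measurable[OF that \<delta>F DF[OF that]] .
  have DM: "D k \<in> borel_measurable M" if "k \<le> N" for k
    using filtration_measurable[OF grid_ge DF[OF that order.refl]] .
  have "0 \<le> K"
  proof -
    have "0 \<le> expectation (\<lambda>\<omega>. (norm (D 0 \<omega>))\<^sup>2)" by simp
    also have "\<dots> \<le> K" by (rule past(2)) simp
    finally show ?thesis .
  qed
  define G where "G \<omega> = g ?t (X n \<omega>) (delayed \<psi> X n \<omega>) - g ?t (Y n \<omega>) (delayed \<phi> Y n \<omega>)" for \<omega>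
  have GF: "G \<in> borel_measurable (F ?t)"
    unfolding G_def
    by (intro borel_measurable_diff diffusion_measurable grid_in_interval delayed_measurable nN
        XF YF \<psi> \<phi>) auto
  let ?del = "\<lambda>\<omega>. (norm (delayed \<delta> D n \<omega>))\<^sup>2"
  have del: "integrable M ?del" "expectation ?del \<le> K"
    by (rule delayed_mean_square[OF nN(1) hist past filtration_measurable[OF grid_ge delF[OF nN(1)]]];
        assumption)+
  let ?GB = "\<lambda>\<omega>. (\<gamma>1\<^sup>2 + \<gamma>1 * \<gamma>2) * (norm (D n \<omega>))\<^sup>2 + (\<gamma>1 * \<gamma>2 + \<gamma>2\<^sup>2) * ?del \<omega>"
  have GB: "(norm (G \<omega>))\<^sup>2 \<le> ?GB \<omega>" for \<omega>
    using diffusion_square_bound[OF grid_in_interval[OF nN(1)], of "X n \<omega>" "delayed \<psi> X n \<omega>"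
        "Y n \<omega>" "delayed \<phi> Y n \<omega>"]
    unfolding G_def delayed_diff[OF nN(1)] D_def \<delta>_def .
  have GBi: "integrable M ?GB" using del(1) past(1)[of n] by simp
  have G2: "integrable M (\<lambda>\<omega>. (norm (G \<omega>))\<^sup>2)"
  proof (rule Bochner_Integration.integrable_bound[OF GBi])
    show "AE \<omega> in M. norm ((norm (G \<omega>))\<^sup>2) \<le> norm (?GB \<omega>)"
      using GB by (intro AE_I2) (auto intro: order_trans[OF _ abs_ge_self])
  qed (use filtration_measurable[OF grid_ge GF] in measurable)
  have GE: "expectation (\<lambda>\<omega>. (norm (G \<omega>))\<^sup>2) \<le> (\<gamma>1 + \<gamma>2)\<^sup>2 * K"
  proof -
    have "expectation (\<lambda>\<omega>. (norm (G \<omega>))\<^sup>2) \<le> expectation ?GB"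
      by (rule integral_mono[OF G2 GBi GB])
    also have "\<dots> = (\<gamma>1\<^sup>2 + \<gamma>1 * \<gamma>2) * expectation (\<lambda>\<omega>. (norm (D n \<omega>))\<^sup>2)
        + (\<gamma>1 * \<gamma>2 + \<gamma>2\<^sup>2) * expectation ?del"
      using del(1) past(1)[of n] by simp
    also have "\<dots> \<le> (\<gamma>1\<^sup>2 + \<gamma>1 * \<gamma>2) * K + (\<gamma>1 * \<gamma>2 + \<gamma>2\<^sup>2) * K"
      using del(2) past(2)[of n] coefficients_nonneg by (intro add_mono mult_left_mono) auto
    finally show ?thesis by (simp add: power2_eq_square algebra_simps)
  qed
  let ?R = "\<lambda>\<omega>. (norm (D n \<omega> + G \<omega> *v noise n \<omega>))\<^sup>2"
  have "has_bochner_integral M ?R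
      (expectation (\<lambda>\<omega>. (norm (D n \<omega>))\<^sup>2) + (?t' - ?t) * expectation (\<lambda>\<omega>. (norm (G \<omega>))\<^sup>2))"
    using h_pos past(1) G2
    by (intro has_expectation_norm_square_noise_step grid_ge DF GF nN) (auto simp: grid_Suc)
  then have R: "integrable M ?R"
    "expectation ?R = expectation (\<lambda>\<omega>. (norm (D n \<omega>))\<^sup>2) + h * expectation (\<lambda>\<omega>. (norm (G \<omega>))\<^sup>2)"
    by (simp_all add: has_bochner_integral_iff grid_Suc)
  have RE: "expectation ?R \<le> K + h * ((\<gamma>1 + \<gamma>2)\<^sup>2 * K)"
    unfolding R(2) using past(2)[of n] GE h_pos by (intro add_mono mult_left_mono) auto
  obtain s u v where s: "s \<in> {a - \<tau>0..a}" and uv: "0 \<le> u" "\<And>k. 0 \<le> v k" "u + (\<Sum>k\<le>Suc n. v k) = 1"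
    and *: "\<And>\<psi> X \<omega>. delayed \<psi> X (Suc n) \<omega> = u *\<^sub>R \<psi> s \<omega> + (\<Sum>k\<le>Suc n. v k *\<^sub>R X k \<omega>)"
    by (rule delay_weights[OF nN(2)]) (rule that)
  \<comment> \<open>\<open>l\<close> is the weight of the unknown in its own delayed argument; the
    remaining weights, of total \<open>1 - l\<close>, fall on quantities already bounded by
    \<open>K\<close>.\<close>
  define l where "l = v (Suc n)"
  have l: "0 \<le> l" "l \<le> 1" and ul: "u + (\<Sum>k\<le>n. v k) = 1 - l"
    using uv sum_nonneg[of "{..n}" v] by (auto simp: l_def)
  let ?H = "\<lambda>\<omega>. u * (norm (\<delta> s \<omega>))\<^sup>2 + (\<Sum>k\<le>n. v k * (norm (D k \<omega>))\<^sup>2)"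
  have H: "integrable M ?H" "expectation ?H \<le> (u + (\<Sum>k\<le>n. v k)) * K"
    by (rule integral_convex_combination_le[OF uv(1,2) hist(1)[OF s] hist(2)[OF s] past]; assumption)+
  have HE: "expectation ?H \<le> (1 - l) * K" using H(2) unfolding ul .
  \<comment> \<open>\<open>q\<close> is the coefficient of the new squared norm after the share
    \<open>h * \<beta> * l\<close> from the delayed argument has been moved to the left.\<close>
  define q where "q = 1 - 2 * h * \<alpha> - h * \<beta> - h * \<beta> * l"
  have h\<beta>: "0 \<le> h * \<beta>" using h_pos coefficients_nonneg by simp
  have q_eq: "q = (1 - 2 * h * \<alpha> - 2 * h * \<beta>) + h * \<beta> * (1 - l)"
    by (simp add: q_def algebra_simps)
  have "0 \<le> h * \<beta> * (1 - l)" using h\<beta> l by simp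
  then have q: "0 < q" using step_small unfolding q_eq by linarith
  have AE: "AE \<omega> in M. q * (norm (D (Suc n) \<omega>))\<^sup>2 \<le> h * \<beta> * ?H \<omega> + ?R \<omega>"
    using backward_euler_AE(2)[OF X n] backward_euler_AE(2)[OF Y n]
  proof eventually_elim
    fix \<omega>
    assume x: "X (Suc n) \<omega> = X n \<omega> + h *\<^sub>R f ?t' (X (Suc n) \<omega>) (delayed \<psi> X (Suc n) \<omega>)
        + g ?t (X n \<omega>) (delayed \<psi> X n \<omega>) *v noise n \<omega>"
      and y: "Y (Suc n) \<omega> = Y n \<omega> + h *\<^sub>R f ?t' (Y (Suc n) \<omega>) (delayed \<phi> Y (Suc n) \<omega>)
        + g ?t (Y n \<omega>) (delayed \<phi> Y n \<omega>) *v noise n \<omega>"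
    define fd where "fd = f ?t' (X (Suc n) \<omega>) (delayed \<psi> X (Suc n) \<omega>)
        - f ?t' (Y (Suc n) \<omega>) (delayed \<phi> Y (Suc n) \<omega>)"
    have eq: "(X (Suc n) \<omega> - Y (Suc n) \<omega>) - h *\<^sub>R fd = D n \<omega> + G \<omega> *v noise n \<omega>"
    proof -
      have "(x' - y') - (p - p') = (x - y) + (q - q')"
        if "x' = x + p + q" "y' = y + p' + q'" for x y x' y' p p' q q' :: "complex ^ 'd"
        unfolding that by simp
      from this[OF x y] show ?thesis
        unfolding fd_def scaleR_diff_right G_def matrix_vector_mult_diff_rdistrib D_def .
    qed
    have "(1 - 2 * h * \<alpha> - h * \<beta>) * (norm (D (Suc n) \<omega>))\<^sup>2
        \<le> h * \<beta> * (norm (delayed \<delta> D (Suc n) \<omega>))\<^sup>2 + ?R \<omega>"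
      using implicit_step_square_bound[OF grid_in_interval[OF nN(2)], of "X (Suc n) \<omega>" "Y (Suc n) \<omega>"
          "delayed \<psi> X (Suc n) \<omega>" "delayed \<phi> Y (Suc n) \<omega>"]
      unfolding fd_def[symmetric] eq unfolding delayed_diff[OF nN(2)] D_def \<delta>_def .
    also have "h * \<beta> * (norm (delayed \<delta> D (Suc n) \<omega>))\<^sup>2
        \<le> h * \<beta> * (?H \<omega> + l * (norm (D (Suc n) \<omega>))\<^sup>2)"
      using norm_convex_combination_square_le[OF uv, of "\<delta> s \<omega>" "\<lambda>k. D k \<omega>"] h\<beta>
      unfolding * by (intro mult_left_mono) (simp_all add: l_def add.assoc)
    finally show "q * (norm (D (Suc n) \<omega>))\<^sup>2 \<le> h * \<beta> * ?H \<omega> + ?R \<omega>"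
      unfolding q_def by (simp add: algebra_simps)
  qed
  have bound: "integrable M (\<lambda>\<omega>. h * \<beta> * ?H \<omega> + ?R \<omega>)"
    by (intro Bochner_Integration.integrable_add integrable_mult_right H(1) R(1))
  \<comment> \<open>Square integrability of the new difference is not known beforehand; as
    \<open>q > 0\<close>, it follows by domination from the almost sure bound.\<close>
  have qD: "integrable M (\<lambda>\<omega>. q * (norm (D (Suc n) \<omega>))\<^sup>2)"
  proof (rule Bochner_Integration.integrable_bound[OF bound])
    show "AE \<omega> in M. norm (q * (norm (D (Suc n) \<omega>))\<^sup>2) \<le> norm (h * \<beta> * ?H \<omega> + ?R \<omega>)"
      using AE by eventually_elim (use q in \<open>simp add: abs_mult\<close>)
  qed (use DM[OF nN(2)] in measurable)
  then show int: "integrable M (\<lambda>\<omega>. (norm (D (Suc n) \<omega>))\<^sup>2)" using q by simp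
  have "q * expectation (\<lambda>\<omega>. (norm (D (Suc n) \<omega>))\<^sup>2) = expectation (\<lambda>\<omega>. q * (norm (D (Suc n) \<omega>))\<^sup>2)"
    by simp
  also have "\<dots> \<le> expectation (\<lambda>\<omega>. h * \<beta> * ?H \<omega> + ?R \<omega>)"
    by (rule integral_mono_AE[OF qD bound AE])
  also have "\<dots> = h * \<beta> * expectation ?H + expectation ?R"
    by (subst Bochner_Integration.integral_add[OF integrable_mult_right[OF H(1)] R(1)]) simp
  also have "\<dots> \<le> h * \<beta> * ((1 - l) * K) + (K + h * ((\<gamma>1 + \<gamma>2)\<^sup>2 * K))"
    using HE RE h\<beta> by (intro add_mono mult_left_mono) auto
  also have "\<dots> = (h * \<beta> * (1 - l) + (1 + h * (\<gamma>1 + \<gamma>2)\<^sup>2)) * K"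
    by (simp add: algebra_simps)
  \<comment> \<open>Adding the nonnegative \<open>h * \<beta> * (1 - l)\<close> to both
    \<open>P\<close> and \<open>Q\<close> keeps \<open>P \<le> r * Q\<close> true because
    \<open>r \<ge> 1\<close>.\<close>
  also have "\<dots> \<le> (r * q) * K"
  proof (rule mult_right_mono[OF _ \<open>0 \<le> K\<close>])
    have "h * \<beta> * (1 - l) \<le> r * (h * \<beta> * (1 - l))"
      using mult_right_mono[OF r(1) \<open>0 \<le> h * \<beta> * (1 - l)\<close>] by simp
    then show "h * \<beta> * (1 - l) + (1 + h * (\<gamma>1 + \<gamma>2)\<^sup>2) \<le> r * q"
      unfolding q_eq distrib_left using r(2) by linarith
  qed
  finally have "q * expectation (\<lambda>\<omega>. (norm (D (Suc n) \<omega>))\<^sup>2) \<le> q * (r * K)"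
    by (simp add: mult_ac)
  then show "expectation (\<lambda>\<omega>. (norm (D (Suc n) \<omega>))\<^sup>2) \<le> r * K"
    using q by (rule mult_left_le_imp_le)
qed

text \<open>All \<open>k \<le> n\<close> share the bound \<open>r ^ n * K\<close>, which is the
  uniform bound on the past required by \<open>difference_step\<close>. As \<open>r \<ge> 1\<close>,
  earlier bounds and the history bound remain valid at later stages.\<close>

lemma difference_growth:
  fixes \<psi> \<phi> :: "real \<Rightarrow> 'w \<Rightarrow> complex ^ 'd" and X Y :: "nat \<Rightarrow> 'w \<Rightarrow> complex ^ 'd"
  assumes X: "backward_euler M w a h N \<tau> f g \<psi> X" and Y: "backward_euler M w a h N \<tau> f g \<phi> Y"
    and \<psi>: "\<And>s. s \<in> {a - \<tau>0..a} \<Longrightarrow> \<psi> s \<in> borel_measurable (F a)"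
    and \<phi>: "\<And>s. s \<in> {a - \<tau>0..a} \<Longrightarrow> \<phi> s \<in> borel_measurable (F a)"
    and hist: "\<And>s. s \<in> {a - \<tau>0..a} \<Longrightarrow> integrable M (\<lambda>\<omega>. (norm (\<psi> s \<omega> - \<phi> s \<omega>))\<^sup>2)"
      "\<And>s. s \<in> {a - \<tau>0..a} \<Longrightarrow> expectation (\<lambda>\<omega>. (norm (\<psi> s \<omega> - \<phi> s \<omega>))\<^sup>2) \<le> K"
    and r: "1 \<le> r" "1 + h * (\<gamma>1 + \<gamma>2)\<^sup>2 \<le> r * (1 - 2 * h * \<alpha> - 2 * h * \<beta>)"
    and "n \<le> N" "k \<le> n"
  shows "integrable M (\<lambda>\<omega>. (norm (X k \<omega> - Y k \<omega>))\<^sup>2) \<and>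
    expectation (\<lambda>\<omega>. (norm (X k \<omega> - Y k \<omega>))\<^sup>2) \<le> r ^ n * K"
  using assms(9,10)
proof (induction n arbitrary: k)
  case 0
  have a: "a \<in> {a - \<tau>0..a}" using problem by (simp add: delay_problem_def)
  have M: "X 0 \<in> borel_measurable M" "Y 0 \<in> borel_measurable M"
    "\<psi> a \<in> borel_measurable M" "\<phi> a \<in> borel_measurable M"
    using filtration_measurable[OF grid_ge backward_euler_adapted[OF X \<psi>, of 0]]
      filtration_measurable[OF grid_ge backward_euler_adapted[OF Y \<phi>, of 0]]
      filtration_measurable[OF order.refl \<psi>[OF a]] filtration_measurable[OF order.refl \<phi>[OF a]]
    by auto
  have AE: "AE \<omega> in M. (norm (X 0 \<omega> - Y 0 \<omega>))\<^sup>2 = (norm (\<psi> a \<omega> - \<phi> a \<omega>))\<^sup>2"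
    using backward_euler_AE(1)[OF X] backward_euler_AE(1)[OF Y] by eventually_elim simp
  have "integrable M (\<lambda>\<omega>. (norm (X 0 \<omega> - Y 0 \<omega>))\<^sup>2)"
    by (rule integrable_cong_AE_imp[OF hist(1)[OF a]]) (use M AE in auto)
  moreover have "expectation (\<lambda>\<omega>. (norm (X 0 \<omega> - Y 0 \<omega>))\<^sup>2) = expectation (\<lambda>\<omega>. (norm (\<psi> a \<omega> - \<phi> a \<omega>))\<^sup>2)"
    by (rule integral_cong_AE) (use M AE in auto)
  ultimately show ?case using 0 hist(2)[OF a] by simp
next
  case (Suc n)
  have n: "n < N" "n \<le> N" using Suc.prems by auto
  note IH = Suc.IH[OF n(2)]
  have "0 \<le> expectation (\<lambda>\<omega>. (norm (\<psi> a \<omega> - \<phi> a \<omega>))\<^sup>2)" by simp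
  also have "\<dots> \<le> K" using problem by (intro hist(2)) (simp add: delay_problem_def)
  finally have K: "0 \<le> K" .
  have K1: "K \<le> r ^ n * K"
    using mult_right_mono[OF one_le_power[OF r(1), of n] K] by simp
  have K2: "r ^ n * K \<le> r ^ Suc n * K"
    using mult_right_mono[OF power_increasing[OF _ r(1), of n "Suc n"] K] by simp
  have hist': "expectation (\<lambda>\<omega>. (norm (\<psi> s \<omega> - \<phi> s \<omega>))\<^sup>2) \<le> r ^ n * K" if "s \<in> {a - \<tau>0..a}" for s
    using hist(2)[OF that] K1 by linarith
  show ?case
  proof (cases "k = Suc n")
    case True
    have "integrable M (\<lambda>\<omega>. (norm (X (Suc n) \<omega> - Y (Suc n) \<omega>))\<^sup>2)"
      "expectation (\<lambda>\<omega>. (norm (X (Suc n) \<omega> - Y (Suc n) \<omega>))\<^sup>2) \<le> r * (r ^ n * K)"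
      by (rule difference_step[OF X Y \<psi> \<phi> n(1) hist(1) hist' conjunct1[OF IH] conjunct2[OF IH] r];
          assumption)+
    then show ?thesis using True by (simp add: mult.assoc)
  next
    case False
    then have "k \<le> n" using Suc.prems by simp
    then show ?thesis using IH[of k] K2 by auto
  qed
qed

text \<open>Finite second moments of the histories make the supremum finite, so its real value can
  serve as \<open>K\<close>; the resulting real estimate is then carried back to extended
  values.\<close>

lemma mean_square_difference_le:
  fixes \<psi> \<phi> :: "real \<Rightarrow> 'w \<Rightarrow> complex ^ 'd" and X Y :: "nat \<Rightarrow> 'w \<Rightarrow> complex ^ 'd"
  assumes X: "backward_euler M w a h N \<tau> f g \<psi> X" and Y: "backward_euler M w a h N \<tau> f g \<phi> Y"
    and \<psi>: "\<psi> \<in> Lp_paths M (F a) p (a - \<tau>0) a" and \<phi>: "\<phi> \<in> Lp_paths M (F a) p (a - \<tau>0) a"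
    and "2 \<le> p"
    and r: "1 \<le> r" "1 + h * (\<gamma>1 + \<gamma>2)\<^sup>2 \<le> r * (1 - 2 * h * \<alpha> - 2 * h * \<beta>)"
    and n: "n \<le> N"
  shows "mean_square M (\<lambda>\<omega>. X n \<omega> - Y n \<omega>)
    \<le> ennreal (r ^ n) * (SUP t\<in>{a - \<tau>0..a}. mean_square M (\<lambda>\<omega>. \<psi> t \<omega> - \<phi> t \<omega>))"
proof -
  let ?S = "SUP t\<in>{a - \<tau>0..a}. mean_square M (\<lambda>\<omega>. \<psi> t \<omega> - \<phi> t \<omega>)"
  let ?S\<psi> = "SUP t\<in>{a - \<tau>0..a}. mean_square M (\<psi> t)" and ?S\<phi> = "SUP t\<in>{a - \<tau>0..a}. mean_square M (\<phi> t)"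
  note sub = filtration_subalgebra[OF order.refl]
  have fin: "?S\<psi> < \<infinity>" "?S\<phi> < \<infinity>"
    using Lp_paths_mean_square_finite[OF _ \<open>2 \<le> p\<close> finite_measure_axioms sub] \<psi> \<phi> by blast+
  note \<psi>F = Lp_paths_evaluation_measurable[OF \<psi>] and \<phi>F = Lp_paths_evaluation_measurable[OF \<phi>]
  note \<psi>M = filtration_measurable[OF order.refl \<psi>F] and \<phi>M = filtration_measurable[OF order.refl \<phi>F]
  have "?S \<le> 2 * ?S\<psi> + 2 * ?S\<phi>"
  proof (rule SUP_least)
    fix t assume t: "t \<in> {a - \<tau>0..a}"
    note [measurable] = \<psi>M[OF t] \<phi>M[OF t]
    have "(norm (x - y))\<^sup>2 \<le> 2 * (norm x)\<^sup>2 + 2 * (norm y)\<^sup>2" for x y :: "complex ^ 'd"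
    proof -
      have "(norm (x - y))\<^sup>2 \<le> (norm x + norm y)\<^sup>2"
        by (rule power_mono[OF norm_triangle_ineq4]) simp
      also have "\<dots> \<le> 2 * (norm x)\<^sup>2 + 2 * (norm y)\<^sup>2"
        using sum_squares_bound[of "norm x" "norm y"] by (simp add: power2_sum)
      finally show ?thesis .
    qed
    then have "mean_square M (\<lambda>\<omega>. \<psi> t \<omega> - \<phi> t \<omega>)
        \<le> (\<integral>\<^sup>+\<omega>. 2 * ennreal ((norm (\<psi> t \<omega>))\<^sup>2) + 2 * ennreal ((norm (\<phi> t \<omega>))\<^sup>2) \<partial>M)"
      unfolding mean_square_def
      by (intro nn_integral_mono)
         (simp flip: ennreal_numeral ennreal_mult ennreal_plus)
    also have "\<dots> = 2 * mean_square M (\<psi> t) + 2 * mean_square M (\<phi> t)"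
      by (simp add: mean_square_def nn_integral_add nn_integral_cmult)
    also have "\<dots> \<le> 2 * ?S\<psi> + 2 * ?S\<phi>"
      using t by (intro add_mono mult_left_mono SUP_upper) auto
    finally show "mean_square M (\<lambda>\<omega>. \<psi> t \<omega> - \<phi> t \<omega>) \<le> 2 * ?S\<psi> + 2 * ?S\<phi>" .
  qed
  also have "\<dots> < \<infinity>" using fin by (simp add: ennreal_mult_less_top less_top)
  finally have S: "?S < \<infinity>" .
  have le: "mean_square M (\<lambda>\<omega>. \<psi> t \<omega> - \<phi> t \<omega>) \<le> ?S" if "t \<in> {a - \<tau>0..a}" for t
    using that by (intro SUP_upper)
  have int: "integrable M (\<lambda>\<omega>. (norm (\<psi> t \<omega> - \<phi> t \<omega>))\<^sup>2)" if "t \<in> {a - \<tau>0..a}" for t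
    using \<psi>M[OF that] \<phi>M[OF that] le[OF that] S
    by (intro integrableI_nonneg) (auto simp: mean_square_def)
  have bound: "expectation (\<lambda>\<omega>. (norm (\<psi> t \<omega> - \<phi> t \<omega>))\<^sup>2) \<le> enn2real ?S"
    if "t \<in> {a - \<tau>0..a}" for t
  proof -
    have "ennreal (expectation (\<lambda>\<omega>. (norm (\<psi> t \<omega> - \<phi> t \<omega>))\<^sup>2)) \<le> ennreal (enn2real ?S)"
      using nn_integral_eq_integral[OF int[OF that]] le[OF that] S by (simp add: mean_square_def)
    then show ?thesis by simp
  qed
  have "integrable M (\<lambda>\<omega>. (norm (X n \<omega> - Y n \<omega>))\<^sup>2) \<and>
      expectation (\<lambda>\<omega>. (norm (X n \<omega> - Y n \<omega>))\<^sup>2) \<le> r ^ n * enn2real ?S"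
    by (rule difference_growth[OF X Y \<psi>F \<phi>F int bound r n order.refl])
  then have "mean_square M (\<lambda>\<omega>. X n \<omega> - Y n \<omega>) \<le> ennreal (r ^ n * enn2real ?S)"
    by (simp add: mean_square_def nn_integral_eq_integral ennreal_leI)
  also have "\<dots> = ennreal (r ^ n) * ?S"
    using r(1) S by (simp add: ennreal_mult)
  finally show ?thesis .
qed

end

section \<open>The two stability estimates\<close>

theorem theorem4p2:
  fixes M :: "'w measure"
    and F :: "real \<Rightarrow> 'w measure"
    and w :: "real \<Rightarrow> 'w \<Rightarrow> real ^ 'm"
    and a b \<tau>0 p \<alpha> \<beta> \<gamma>1 \<gamma>2 h c c1 :: real
    and \<tau> :: "real \<Rightarrow> real"
    and f :: "real \<Rightarrow> complex ^ 'd \<Rightarrow> complex ^ 'd \<Rightarrow> complex ^ 'd"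
    and g :: "real \<Rightarrow> complex ^ 'd \<Rightarrow> complex ^ 'd \<Rightarrow> complex ^ 'm ^ 'd"
    and \<xi> \<eta> :: "real \<Rightarrow> 'w \<Rightarrow> complex ^ 'd"
    and X Y :: "nat \<Rightarrow> 'w \<Rightarrow> complex ^ 'd"
    and N :: nat
  assumes "wiener_process M F a w"
    and "delay_problem a b \<tau>0 \<tau> f g"
    and "SD \<alpha> \<beta> \<gamma>1 \<gamma>2 a b f g"
    and "2 < p"
    and "\<xi> \<in> Lp_paths M (F a) p (a - \<tau>0) a"
    and "\<eta> \<in> Lp_paths M (F a) p (a - \<tau>0) a"
    and "0 < N"
    and h: "h = (b - a) / real N"
    and "backward_euler M w a h N \<tau> f g \<xi> X"
    and "backward_euler M w a h N \<tau> f g \<eta> Y"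
    and c: "c = 2 * \<alpha> + 2 * \<beta> + \<gamma>1\<^sup>2 + 2 * \<gamma>1 * \<gamma>2 + \<gamma>2\<^sup>2"
    and c1: "c1 = max
        ((1 + h * \<gamma>1\<^sup>2 + 2 * h * \<gamma>1 * \<gamma>2 + h * \<gamma>2\<^sup>2) / (1 - 2 * h * \<alpha> - 2 * h * \<beta>))
        ((1 + h * \<beta> + h * \<gamma>1\<^sup>2 + 2 * h * \<gamma>1 * \<gamma>2 + h * \<gamma>2\<^sup>2) / (1 - 2 * h * \<alpha> - h * \<beta>))"
  shows "(0 < c \<longrightarrow> (\<forall>c0. 0 < c0 \<and> c0 < 1 \<and> h * c \<le> c0 \<longrightarrow>
            c1 = (1 + h * \<gamma>1\<^sup>2 + 2 * h * \<gamma>1 * \<gamma>2 + h * \<gamma>2\<^sup>2) / (1 - 2 * h * \<alpha> - 2 * h * \<beta>) \<and>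
            1 < c1 \<and>
            (\<forall>n\<in>{1..N}.
               mean_square M (\<lambda>\<omega>. X n \<omega> - Y n \<omega>)
                 \<le> ennreal (exp (c1 / h * (grid a h n - a)))
                   * (SUP t\<in>{a - \<tau>0..a}. mean_square M (\<lambda>\<omega>. \<xi> t \<omega> - \<eta> t \<omega>))))) \<and>
         (c \<le> 0 \<longrightarrow>
            (\<forall>n\<in>{1..N}.
               mean_square M (\<lambda>\<omega>. X n \<omega> - Y n \<omega>)
                 \<le> (SUP t\<in>{a - \<tau>0..a}. mean_square M (\<lambda>\<omega>. \<xi> t \<omega> - \<eta> t \<omega>))))"
proof -
  let ?S = "SUP t\<in>{a - \<tau>0..a}. mean_square M (\<lambda>\<omega>. \<xi> t \<omega> - \<eta> t \<omega>)"
  define P where "P = 1 + h * (\<gamma>1 + \<gamma>2)\<^sup>2"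
  define Q where "Q = 1 - 2 * h * \<alpha> - 2 * h * \<beta>"
  have h_pos: "0 < h"
    using \<open>delay_problem a b \<tau>0 \<tau> f g\<close> \<open>0 < N\<close> by (simp add: delay_problem_def h)
  have P_pos: "0 < P"
    using h_pos by (simp add: P_def add_pos_nonneg)
  have P: "1 + h * \<gamma>1\<^sup>2 + 2 * h * \<gamma>1 * \<gamma>2 + h * \<gamma>2\<^sup>2 = P"
    "1 + h * \<beta> + h * \<gamma>1\<^sup>2 + 2 * h * \<gamma>1 * \<gamma>2 + h * \<gamma>2\<^sup>2 = P + h * \<beta>"
    by (simp_all add: P_def power2_eq_square algebra_simps)
  have Q: "1 - 2 * h * \<alpha> - h * \<beta> = Q + h * \<beta>" by (simp add: Q_def)
  \<comment> \<open>The sign of \<open>c\<close> thus decides whether the growth ratio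
    \<open>P / Q\<close> exceeds \<open>1\<close>.\<close>
  have PQ: "P - Q = h * c" by (simp add: P_def Q_def c power2_eq_square algebra_simps)
  have main: "mean_square M (\<lambda>\<omega>. X n \<omega> - Y n \<omega>) \<le> ennreal (r ^ n) * ?S" and \<beta>: "0 \<le> \<beta>"
    if "0 < Q" "1 \<le> r" "P \<le> r * Q" "n \<le> N" for r n
  proof -
    interpret wiener_process M F a w by fact
    interpret backward_euler_problem M F a w b \<tau>0 \<alpha> \<beta> \<gamma>1 \<gamma>2 h \<tau> f g N
      using assms that by unfold_locales (auto simp: Q_def)
    show "mean_square M (\<lambda>\<omega>. X n \<omega> - Y n \<omega>) \<le> ennreal (r ^ n) * ?S"
      using mean_square_difference_le[OF assms(9,10,5,6) _ that(2) _ that(4)] that(3) \<open>2 < p\<close>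
      by (simp add: P_def Q_def)
    show "0 \<le> \<beta>" by (rule coefficients_nonneg)
  qed
  have i: "c1 = P / Q \<and> 1 < c1 \<and> (\<forall>n\<in>{1..N}. mean_square M (\<lambda>\<omega>. X n \<omega> - Y n \<omega>)
      \<le> ennreal (exp (c1 / h * (grid a h n - a))) * ?S)"
    if "0 < c" "c0 < 1" "h * c \<le> c0" for c0
  proof -
    have "Q < P" using PQ h_pos \<open>0 < c\<close> by (simp add: algebra_simps)
    have "1 \<le> P" using h_pos by (simp add: P_def)
    \<comment> \<open>Here \<open>c0 < 1\<close> enters:
      \<open>Q = P - h * c \<ge> 1 - c0\<close>.\<close>
    then have "0 < Q" using PQ that by linarith
    have r: "1 < P / Q" "P \<le> P / Q * Q" using \<open>0 < Q\<close> \<open>Q < P\<close> by auto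
    \<comment> \<open>The values \<open>P / Q\<close> and \<open>0\<close> merely discharge the
      premises shared with \<open>main\<close>.\<close>
    have "0 \<le> h * \<beta>" using \<beta>[OF \<open>0 < Q\<close>, of "P / Q" 0] r h_pos by simp
    then have "P * (h * \<beta>) \<ge> Q * (h * \<beta>)"
      using \<open>Q < P\<close> by (intro mult_right_mono) auto
    \<comment> \<open>Adding the same nonnegative number to numerator and denominator of a ratio
      above \<open>1\<close> lowers it, so the maximum is its first entry.\<close>
    then have "(P + h * \<beta>) / (Q + h * \<beta>) \<le> P / Q"
      using \<open>0 < Q\<close> \<open>0 \<le> h * \<beta>\<close> by (simp add: divide_le_eq le_divide_eq algebra_simps)
    then have c1_eq: "c1 = P / Q" unfolding c1 P Q using Q_def by simp
    have "mean_square M (\<lambda>\<omega>. X n \<omega> - Y n \<omega>) \<le> ennreal (exp (c1 / h * (grid a h n - a))) * ?S"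
      if "n \<in> {1..N}" for n
    proof -
      \<comment> \<open>This crude bound turns the discrete growth into the exponential rate
        \<open>c1 / h\<close>, since \<open>n * h\<close> is the elapsed time.\<close>
      have "P / Q \<le> exp (P / Q)"
        using exp_ge_add_one_self[of "P / Q"] by linarith
      then have "(P / Q) ^ n \<le> exp (P / Q) ^ n"
        using r(1) by (intro power_mono) auto
      also have "\<dots> = exp (c1 / h * (grid a h n - a))"
        using h_pos by (simp add: c1_eq grid_def exp_of_nat_mult[symmetric] mult.commute)
      finally have "ennreal ((P / Q) ^ n) * ?S \<le> ennreal (exp (c1 / h * (grid a h n - a))) * ?S"
        by (intro mult_right_mono ennreal_leI) auto
      moreover have "mean_square M (\<lambda>\<omega>. X n \<omega> - Y n \<omega>) \<le> ennreal ((P / Q) ^ n) * ?S"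
        using r that by (intro main[OF \<open>0 < Q\<close>]) auto
      ultimately show ?thesis by order
    qed
    with c1_eq r show ?thesis by blast
  qed
  have ii: "mean_square M (\<lambda>\<omega>. X n \<omega> - Y n \<omega>) \<le> ?S" if "c \<le> 0" "n \<in> {1..N}" for n
  proof -
    \<comment> \<open>Hence growth factor \<open>r = 1\<close> is admissible and nothing accumulates
      over the steps.\<close>
    have "P \<le> Q" using PQ h_pos \<open>c \<le> 0\<close> by (smt (verit) mult_nonneg_nonpos)
    then show ?thesis using main[of 1 n] P_pos that by simp
  qed
  show ?thesis
    unfolding P Q_def[symmetric] using i ii by blast
qed

end
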